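(* There is a quantum algorithm (tester) with the following guarantee. Let $n$ be a positive integer, let $\epsilon \in (0,1)$, and let $p=(p_i)_{i=1}^n$ and $q=(q_i)_{i=1}^n$ be probability distributions on $[n]$ given by purified quantum query-access oracles $U_p$ and $U_q$. Under the promise that either $p=q$ or $\|p-q\|_1 \ge \epsilon$, the algorithm decides which of the two is the case with probability at least $\frac{2}{3}$, using $O\!\left(\frac{\sqrt{n}}{\epsilon}\right)$ calls to $U_p$, $U_q$, their inverses or their controlled versions.
   Context: Notation: $[n]=\{1,\dots,n\}$, and $\|p-q\|_1 := \sum_{i=1}^n |p_i-q_i|$. Purified quantum query-access: a classical distribution $(p_i)_{i=1}^n$ on $[n]$ has purified quantum query-access if one has access to a unitary oracle $U_p$ (and to its inverse and controlled versions) on a bipartite system $A\otimes B$ acting as $$U_p |0\rangle_A |0\rangle_B = \sum_{i=1}^n \sqrt{p_i}\, |\phi_i\rangle_A |i\rangle_B,$$ where $\langle \phi_i|\phi_j\rangle=\delta_{ij}$. Here $A$ and $B$ are finite-dimensional Hilbert spaces, $B=\mathbb{C}^n=\mathrm{span}\{|1\rangle,\dots,|n\rangle\}$ with orthonormal basis $|1\rangle,\dots,|n\rangle$, and $|0\rangle_A$, $|0\rangle_B$ denote fixed reference unit vectors. The oracle $U_q$ for $q$ is of the same form (with its own orthonormal vectors in place of the $|\phi_i\rangle$), on the same systems $A$, $B$ with the same reference vectors. A quantum algorithm in this model knows the parameters $n,\epsilon$ but has access to $p$ and $q$ only through the oracles. It applies calls to the oracles interleaved with oracle-independent unitaries and measurements,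 and outputs a decision. The complexity is the number of oracle calls. The constant in $O(\cdot)$ is universal. *)

theory Defs
  imports Complex_Main "Jordan_Normal_Form.Schur_Decomposition"
begin

text \<open>The basis vector $|k\rangle \otimes |l\rangle$ of $C^a \otimes C^b$ has index $k b + l$.\<close>

definition kron :: "complex mat \<Rightarrow> complex mat \<Rightarrow> complex mat" where
  "kron M N = mat (dim_row M * dim_row N) (dim_col M * dim_col N)
     (\<lambda>(i, j). M $$ (i div dim_row N, j div dim_col N) * N $$ (i mod dim_row N, j mod dim_col N))"

definition kron_vec :: "complex vec \<Rightarrow> complex vec \<Rightarrow> complex vec" where
  "kron_vec u v = vec (dim_vec u * dim_vec v) (\<lambda>i. u $ (i div dim_vec v) * v $ (i mod dim_vec v))"

definition unitary_mat :: "nat \<Rightarrow> complex mat \<Rightarrow> bool" where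
  "unitary_mat d U \<longleftrightarrow>
     U \<in> carrier_mat d d \<and> mat_adjoint U * U = 1\<^sub>m d \<and> U * mat_adjoint U = 1\<^sub>m d"

definition unit_state :: "nat \<Rightarrow> complex vec \<Rightarrow> bool" where
  "unit_state d v \<longleftrightarrow> v \<in> carrier_vec d \<and> v \<bullet>c v = 1"

text \<open>Complete projective measurement with outcomes \<open>0, \<dots>, m - 1\<close>.\<close>

definition projective_measurement :: "nat \<Rightarrow> nat \<Rightarrow> (nat \<Rightarrow> complex mat) \<Rightarrow> bool" where
  "projective_measurement d m P \<longleftrightarrow>
     (\<forall>k<m. P k \<in> carrier_mat d d \<and> mat_adjoint (P k) = P k) \<and>
     (\<forall>k<m. \<forall>l<m. P k * P l = (if k = l then P k else 0\<^sub>m d d)) \<and>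
     mat d d (\<lambda>ij. \<Sum>k<m. P k $$ ij) = 1\<^sub>m d"

text \<open>Distributions on an \<open>n\<close>-element set; the outcomes are numbered from 0.\<close>

definition distribution :: "nat \<Rightarrow> (nat \<Rightarrow> real) \<Rightarrow> bool" where
  "distribution n p \<longleftrightarrow> (\<forall>i<n. 0 \<le> p i) \<and> (\<Sum>i<n. p i) = 1"

text \<open>\<open>U\<close> gives purified query-access to \<open>p\<close> on $A \otimes B$, where $A = C^{dA}$ and
  $B = C^n$, with reference states \<open>a0\<close>, \<open>b0\<close>. No relation between \<open>b0\<close> and the computational
  basis of \<open>B\<close> is imposed, and \<open>U\<close> is unconstrained on the complement of the reference state.\<close>

definition purified_oracle ::
  "nat \<Rightarrow> nat \<Rightarrow> complex vec \<Rightarrow> complex vec \<Rightarrow> (nat \<Rightarrow> real) \<Rightarrow> complex mat \<Rightarrow> bool" where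
  "purified_oracle dA n a0 b0 p U \<longleftrightarrow>
     unitary_mat (dA * n) U \<and>
     (\<exists>\<phi>. (\<forall>i<n. \<phi> i \<in> carrier_vec dA) \<and>
          (\<forall>i<n. \<forall>j<n. \<phi> i \<bullet>c \<phi> j = (if i = j then 1 else 0)) \<and>
          U *\<^sub>v kron_vec a0 b0 =
            vec (dA * n) (\<lambda>k. \<Sum>i<n. complex_of_real (sqrt (p i)) *
                                      kron_vec (\<phi> i) (unit_vec n i) $ k))"

text \<open>Query algorithms with two oracles. They run on $C^2 \otimes (A \otimes B) \otimes W$: a control
  qubit, the systems the oracles act on, and a workspace \<open>W\<close> whose dimension the algorithm chooses.
  Calls on other registers are covered by conjugating with swaps. Programs are
  adaptive: what follows a measurement may depend on its outcome.\<close>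

datatype oracle_id = Oracle_p | Oracle_q

datatype call_mode = Plain | Inverse | Controlled | Controlled_Inverse

datatype program =
    Output bool
  | Unitary "complex mat" program
  | Call oracle_id call_mode program
  | Measure nat "nat \<Rightarrow> complex mat" "nat \<Rightarrow> program"

abbreviation total_dim :: "nat \<Rightarrow> nat \<Rightarrow> nat \<Rightarrow> nat" where
  "total_dim dA n dW \<equiv> 2 * (dA * n) * dW"

definition controlled :: "complex mat \<Rightarrow> complex mat" where
  "controlled U = four_block_mat
     (1\<^sub>m (dim_row U)) (0\<^sub>m (dim_row U) (dim_col U)) (0\<^sub>m (dim_row U) (dim_col U)) U"

fun call_mat :: "nat \<Rightarrow> complex mat \<Rightarrow> call_mode \<Rightarrow> complex mat" where
  "call_mat dW U Plain = kron (kron (1\<^sub>m 2) U) (1\<^sub>m dW)"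
| "call_mat dW U Inverse = kron (kron (1\<^sub>m 2) (mat_adjoint U)) (1\<^sub>m dW)"
| "call_mat dW U Controlled = kron (controlled U) (1\<^sub>m dW)"
| "call_mat dW U Controlled_Inverse = kron (controlled (mat_adjoint U)) (1\<^sub>m dW)"

primrec valid_program :: "nat \<Rightarrow> program \<Rightarrow> bool" where
  "valid_program d (Output b) \<longleftrightarrow> True"
| "valid_program d (Unitary V K) \<longleftrightarrow> unitary_mat d V \<and> valid_program d K"
| "valid_program d (Call orc c K) \<longleftrightarrow> valid_program d K"
| "valid_program d (Measure m P K) \<longleftrightarrow>
     0 < m \<and> projective_measurement d m P \<and> (\<forall>k<m. valid_program d (K k))"

text \<open>Worst case over all measurement outcomes.\<close>

primrec calls :: "program \<Rightarrow> nat" where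
  "calls (Output b) = 0"
| "calls (Unitary V K) = calls K"
| "calls (Call orc c K) = Suc (calls K)"
| "calls (Measure m P K) = Max ((\<lambda>k. calls (K k)) ` {..<m})"

text \<open>Probability that the output is \<open>b\<close>. Post-measurement states are not renormalised, so that the
  squared norm of the state at a leaf is, by the Born rule, the probability of reaching that leaf.\<close>

primrec output_prob ::
  "nat \<Rightarrow> complex mat \<Rightarrow> complex mat \<Rightarrow> bool \<Rightarrow> program \<Rightarrow> complex vec \<Rightarrow> real" where
  "output_prob dW Up Uq b (Output b') = (\<lambda>\<psi>. if b' = b then Re (\<psi> \<bullet>c \<psi>) else 0)"
| "output_prob dW Up Uq b (Unitary V K) = (\<lambda>\<psi>. output_prob dW Up Uq b K (V *\<^sub>v \<psi>))"
| "output_prob dW Up Uq b (Call orc c K) = (\<lambda>\<psi>. output_prob dW Up Uq b K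
     (call_mat dW (case orc of Oracle_p \<Rightarrow> Up | Oracle_q \<Rightarrow> Uq) c *\<^sub>v \<psi>))"
| "output_prob dW Up Uq b (Measure m P K) =
     (\<lambda>\<psi>. \<Sum>k<m. output_prob dW Up Uq b (K k) (P k *\<^sub>v \<psi>))"

definition initial_state :: "nat \<Rightarrow> complex vec \<Rightarrow> complex vec \<Rightarrow> complex vec" where
  "initial_state dW a0 b0 = kron_vec (kron_vec (unit_vec 2 0) (kron_vec a0 b0)) (unit_vec dW 0)"

end

theory Submission
  imports Defs
begin

text \<open>Preparing $U_p|0\rangle$, copying the register \<open>B\<close> to a fresh workspace and undoing the
  preparation leaves the state $\sum_i p_i |i\rangle$ on the workspace as the part in which $A \otimes B$
  is back in its reference state: this no longer depends on the vectors $|\phi_i\rangle$. Doing this for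
  \<open>p\<close> and \<open>q\<close> in superposition, with Hadamard gates on the control qubit before and after, makes the
  marked part (control 1, reference state) have squared norm $\frac14 \|p-q\|_2^2 = \sin^2\theta$. It
  vanishes for $p = q$ and is at least $\epsilon^2/(4n)$ if $\|p-q\|_1 \ge \epsilon$.

  One round of amplitude amplification triples the angle \<open>\<theta>\<close> and the number of calls. As \<open>\<theta>\<close> is
  unknown, all numbers of rounds \<open>k \<le> K\<close> are tried, where $3^K$ is about $\sqrt n/\epsilon$: some
  $3^k\theta$ falls into $[\pi/6, \pi/2]$, where a run succeeds with probability at least $1/4$, so four
  runs per \<open>k\<close> suffice. The cost is a geometric sum.\<close>

section \<open>Adjoints, inner products and unitary matrices\<close>

lemma mat_adjoint_dim [simp]:
  "dim_row (mat_adjoint A) = dim_col A" "dim_col (mat_adjoint A) = dim_row A"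
  by (auto simp: mat_adjoint_def)

lemma mat_adjoint_carrier [simp]: "A \<in> carrier_mat r c \<Longrightarrow> mat_adjoint A \<in> carrier_mat c r"
  by (intro carrier_matI) auto

lemma mat_adjoint_index [simp]:
  fixes A :: "complex mat"
  shows "i < dim_col A \<Longrightarrow> j < dim_row A \<Longrightarrow> mat_adjoint A $$ (i, j) = cnj (A $$ (j, i))"
  by (simp add: mat_adjoint_def mat_of_rows_index)

lemma mat_adjoint_adjoint [simp]: "mat_adjoint (mat_adjoint A) = (A :: complex mat)"
  by (rule eq_matI) auto

lemma mat_adjoint_one [simp]: "mat_adjoint (1\<^sub>m k) = (1\<^sub>m k :: complex mat)"
  by (rule eq_matI) auto

lemma mat_adjoint_mult:
  fixes A B :: "complex mat"
  assumes "dim_col A = dim_row B"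
  shows "mat_adjoint (A * B) = mat_adjoint B * mat_adjoint A"
  using assms by (intro eq_matI) (auto simp: scalar_prod_def intro!: sum.cong)

lemma cscalar_prod_sum:
  fixes u v :: "complex vec"
  shows "u \<bullet>c v = (\<Sum>i<dim_vec v. u $ i * cnj (v $ i))"
  by (simp add: scalar_prod_def lessThan_atLeast0)

lemma Re_cscalar_prod_self:
  fixes v :: "complex vec"
  shows "Re (v \<bullet>c v) = (\<Sum>i<dim_vec v. (cmod (v $ i))\<^sup>2)"
  by (simp add: cscalar_prod_sum cmod_power2 flip: power2_eq_square)

lemma cscalar_prod_mat_adjoint:
  fixes A :: "complex mat"
  assumes "A \<in> carrier_mat r c" "u \<in> carrier_vec c" "v \<in> carrier_vec r"
  shows "(A *\<^sub>v u) \<bullet>c v = u \<bullet>c (mat_adjoint A *\<^sub>v v)"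
proof -
  have "(A *\<^sub>v u) \<bullet>c v = (\<Sum>i<r. (\<Sum>j<c. A $$ (i, j) * u $ j * cnj (v $ i)))"
    using assms by (simp add: cscalar_prod_sum scalar_prod_def lessThan_atLeast0 sum_distrib_right)
  also have "\<dots> = (\<Sum>j<c. \<Sum>i<r. A $$ (i, j) * u $ j * cnj (v $ i))"
    by (rule sum.swap)
  also have "\<dots> = u \<bullet>c (mat_adjoint A *\<^sub>v v)"
    using assms by (simp add: cscalar_prod_sum scalar_prod_def lessThan_atLeast0 sum_distrib_left mult_ac)
  finally show ?thesis .
qed

lemma unitary_mat_carrier: "unitary_mat d U \<Longrightarrow> U \<in> carrier_mat d d"
  by (simp add: unitary_mat_def)

text \<open>A left inverse of a square matrix is also a right inverse, so one of the two equations
  suffices.\<close>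

lemma unitary_matI:
  assumes "U \<in> carrier_mat d d" "mat_adjoint U * U = 1\<^sub>m d"
  shows "unitary_mat d U"
  using assms mat_mult_left_right_inverse[of "mat_adjoint U" d U] by (simp add: unitary_mat_def)

lemma unitary_mat_one: "unitary_mat d (1\<^sub>m d)"
  by (simp add: unitary_mat_def)

lemma unitary_mat_adjoint: "unitary_mat d U \<Longrightarrow> unitary_mat d (mat_adjoint U)"
  by (simp add: unitary_mat_def)

lemma unitary_mat_mult:
  assumes "unitary_mat d U" "unitary_mat d V"
  shows "unitary_mat d (U * V)"
proof (rule unitary_matI)
  note c = assms[THEN unitary_mat_carrier]
  show "U * V \<in> carrier_mat d d" using c by simp
  have "mat_adjoint (U * V) * (U * V) = mat_adjoint V * (mat_adjoint U * (U * V))"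
    using c by (simp add: mat_adjoint_mult assoc_mult_mat[of _ d d _ d _ d])
  also have "mat_adjoint U * (U * V) = (mat_adjoint U * U) * V"
    using c assoc_mult_mat[of "mat_adjoint U" d d U d V d] by simp
  finally show "mat_adjoint (U * V) * (U * V) = 1\<^sub>m d"
    using assms c by (simp add: unitary_mat_def)
qed

lemma unitary_mat_cscalar_prod:
  assumes "unitary_mat d U" "u \<in> carrier_vec d" "v \<in> carrier_vec d"
  shows "(U *\<^sub>v u) \<bullet>c (U *\<^sub>v v) = u \<bullet>c v"
proof -
  have U: "U \<in> carrier_mat d d" using assms by (simp add: unitary_mat_def)
  have "(U *\<^sub>v u) \<bullet>c (U *\<^sub>v v) = u \<bullet>c (mat_adjoint U *\<^sub>v (U *\<^sub>v v))"
    using U assms by (intro cscalar_prod_mat_adjoint[of _ d d]) auto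
  also have "mat_adjoint U *\<^sub>v (U *\<^sub>v v) = (mat_adjoint U * U) *\<^sub>v v"
    using U assms by (simp add: assoc_mult_mat_vec[of _ d d _ d])
  finally show ?thesis using assms by (simp add: unitary_mat_def)
qed

section \<open>Kronecker products\<close>

text \<open>Grouping the indices into blocks of length \<open>b\<close> turns a sum over a product
  index into a double sum. Every sum over a tensor product below is split this way.\<close>

lemma sum_div_mod:
  fixes f :: "nat \<Rightarrow> nat \<Rightarrow> 'a :: comm_monoid_add"
  shows "(\<Sum>j<a * b. f (j div b) (j mod b)) = (\<Sum>i<a. \<Sum>k<b. f i k)"
proof -
  have "(\<Sum>j<a * b. f (j div b) (j mod b)) = (\<Sum>m<a. \<Sum>j\<in>{m*b..<m*b+b}. f (j div b) (j mod b))"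
    by (rule sum.nat_group[symmetric])
  also have "\<dots> = (\<Sum>m<a. \<Sum>k<b. f m k)"
  proof (rule sum.cong[OF refl])
    fix m
    have "(\<Sum>j\<in>{m*b..<m*b+b}. f (j div b) (j mod b))
      = (\<Sum>k\<in>{0..<b}. f ((k + m*b) div b) ((k + m*b) mod b))"
      using sum.shift_bounds_nat_ivl[of "\<lambda>j. f (j div b) (j mod b)" 0 "m*b" b] by (simp add: add.commute)
    then show "(\<Sum>j\<in>{m*b..<m*b+b}. f (j div b) (j mod b)) = (\<Sum>k<b. f m k)"
      by (simp add: lessThan_atLeast0)
  qed
  finally show ?thesis .
qed

text \<open>The hypothesis already forces \<open>b\<close> to be positive, so the bound on the
  remainder needs no side condition.\<close>

lemma div_mod_less_mult:
  fixes i a b :: nat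
  assumes "i < a * b"
  shows "i div b < a" "i mod b < b"
  using assms by (auto simp: less_mult_imp_div_less intro!: mod_less_divisor gr0I)

lemma kron_dim [simp]:
  "dim_row (kron M N) = dim_row M * dim_row N" "dim_col (kron M N) = dim_col M * dim_col N"
  by (auto simp: kron_def)

lemma kron_carrier:
  "M \<in> carrier_mat a b \<Longrightarrow> N \<in> carrier_mat c d \<Longrightarrow> kron M N \<in> carrier_mat (a * c) (b * d)"
  by (intro carrier_matI) auto

lemma kron_vec_dim [simp]: "dim_vec (kron_vec u v) = dim_vec u * dim_vec v"
  by (simp add: kron_vec_def)

lemma kron_vec_carrier [intro]:
  "u \<in> carrier_vec a \<Longrightarrow> v \<in> carrier_vec b \<Longrightarrow> kron_vec u v \<in> carrier_vec (a * b)"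
  by (intro carrier_vecI) auto

lemma kron_vec_index: "i < dim_vec u * dim_vec v \<Longrightarrow>
    kron_vec u v $ i = u $ (i div dim_vec v) * v $ (i mod dim_vec v)"
  by (simp add: kron_vec_def)

lemma kron_index: "i < dim_row M * dim_row N \<Longrightarrow> j < dim_col M * dim_col N \<Longrightarrow>
    kron M N $$ (i, j) = M $$ (i div dim_row N, j div dim_col N) * N $$ (i mod dim_row N, j mod dim_col N)"
  by (simp add: kron_def)

lemma kron_mult_vec:
  assumes "dim_col M = dim_vec u" "dim_col N = dim_vec v"
  shows "kron M N *\<^sub>v kron_vec u v = kron_vec (M *\<^sub>v u) (N *\<^sub>v v)"
proof (rule eq_vecI)
  fix i assume "i < dim_vec (kron_vec (M *\<^sub>v u) (N *\<^sub>v v))"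
  then have i: "i < dim_row M * dim_row N" by simp
  note i' = div_mod_less_mult[OF i]
  let ?a = "dim_vec u" and ?b = "dim_vec v"
  have "(kron M N *\<^sub>v kron_vec u v) $ i = (\<Sum>j<?a * ?b.
     (M $$ (i div dim_row N, j div ?b) * u $ (j div ?b)) *
     (N $$ (i mod dim_row N, j mod ?b) * v $ (j mod ?b)))"
    using i assms by (auto simp: scalar_prod_def kron_index kron_vec_index lessThan_atLeast0
        intro!: sum.cong)
  also have "\<dots> = (\<Sum>k<?a. \<Sum>l<?b. (M $$ (i div dim_row N, k) * u $ k) *
     (N $$ (i mod dim_row N, l) * v $ l))"
    by (rule sum_div_mod)
  also have "\<dots> = (M *\<^sub>v u) $ (i div dim_row N) * (N *\<^sub>v v) $ (i mod dim_row N)"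
    using i' assms by (simp add: scalar_prod_def lessThan_atLeast0 sum_product)
  finally show "(kron M N *\<^sub>v kron_vec u v) $ i = kron_vec (M *\<^sub>v u) (N *\<^sub>v v) $ i"
    using i by (simp add: kron_vec_index)
qed simp

lemma kron_mult:
  assumes "dim_col A = dim_row C" "dim_col B = dim_row D"
  shows "kron A B * kron C D = kron (A * C) (B * D)"
proof (rule eq_matI)
  fix i j assume "i < dim_row (kron (A * C) (B * D))" "j < dim_col (kron (A * C) (B * D))"
  then have i: "i < dim_row A * dim_row B" and j: "j < dim_col C * dim_col D" by auto
  note i' = div_mod_less_mult[OF i] and j' = div_mod_less_mult[OF j]
  have "(kron A B * kron C D) $$ (i, j) = (\<Sum>k<dim_row C * dim_row D.
     (A $$ (i div dim_row B, k div dim_row D) * C $$ (k div dim_row D, j div dim_col D)) *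
     (B $$ (i mod dim_row B, k mod dim_row D) * D $$ (k mod dim_row D, j mod dim_col D)))"
    using i j assms by (auto simp: scalar_prod_def kron_index lessThan_atLeast0 intro!: sum.cong)
  also have "\<dots> = (\<Sum>k<dim_row C. \<Sum>l<dim_row D.
     (A $$ (i div dim_row B, k) * C $$ (k, j div dim_col D)) *
     (B $$ (i mod dim_row B, l) * D $$ (l, j mod dim_col D)))"
    by (rule sum_div_mod)
  also have "\<dots> = (A * C) $$ (i div dim_row B, j div dim_col D) *
      (B * D) $$ (i mod dim_row B, j mod dim_col D)"
    using i' j' assms by (simp add: scalar_prod_def lessThan_atLeast0 sum_product)
  finally show "(kron A B * kron C D) $$ (i, j) = kron (A * C) (B * D) $$ (i, j)"
    using i j by (simp add: kron_index)
qed auto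

lemma kron_adjoint: "mat_adjoint (kron A B) = kron (mat_adjoint A) (mat_adjoint B)"
  by (rule eq_matI) (auto simp: kron_index div_mod_less_mult)

lemma div_mod_eq_iff:
  fixes i j b :: nat
  shows "i div b = j div b \<and> i mod b = j mod b \<longleftrightarrow> i = j"
  by (metis div_mult_mod_eq)

lemma kron_one: "kron (1\<^sub>m a) (1\<^sub>m b) = (1\<^sub>m (a * b))"
proof (rule eq_matI)
  fix i j assume "i < dim_row (1\<^sub>m (a * b) :: complex mat)" "j < dim_col (1\<^sub>m (a * b) :: complex mat)"
  then show "kron (1\<^sub>m a) (1\<^sub>m b) $$ (i, j) = 1\<^sub>m (a * b) $$ (i, j)"
    using div_mod_eq_iff[of i b j] by (auto simp: kron_index div_mod_less_mult)
qed auto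

lemma unitary_mat_kron:
  assumes "unitary_mat a U" "unitary_mat b V"
  shows "unitary_mat (a * b) (kron U V)"
proof (rule unitary_matI)
  note c = assms[THEN unitary_mat_carrier]
  then show "kron U V \<in> carrier_mat (a * b) (a * b)" by (simp add: kron_carrier)
  show "mat_adjoint (kron U V) * kron U V = 1\<^sub>m (a * b)"
    using c assms by (simp add: kron_adjoint kron_mult kron_one unitary_mat_def)
qed

lemma kron_vec_unit:
  assumes "i < a" "j < b"
  shows "kron_vec (unit_vec a i) (unit_vec b j) = unit_vec (a * b) (i * b + j)"
proof (rule eq_vecI)
  fix k assume "k < dim_vec (unit_vec (a * b) (i * b + j) :: complex vec)"
  then have k: "k < a * b" by simp
  have "(k = i * b + j) \<longleftrightarrow> k div b = i \<and> k mod b = j"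
    using div_mod_eq_iff[of k b "i * b + j"] assms by simp
  then show "kron_vec (unit_vec a i) (unit_vec b j) $ k = unit_vec (a * b) (i * b + j) $ k"
    using k by (auto simp: kron_vec_index div_mod_less_mult unit_vec_def)
qed simp

section \<open>Controlled unitaries\<close>

lemma controlled_carrier:
  "U \<in> carrier_mat d d \<Longrightarrow> controlled U \<in> carrier_mat (2 * d) (2 * d)"
  unfolding controlled_def by (metis carrier_matD four_block_carrier_mat mult_2 one_carrier_mat)

lemma controlled_adjoint:
  assumes "U \<in> carrier_mat d d"
  shows "mat_adjoint (controlled U) = controlled (mat_adjoint U)"
  using assms by (intro eq_matI) (auto simp: controlled_def)

lemma controlled_mult:
  assumes "U \<in> carrier_mat d d" "V \<in> carrier_mat d d"
  shows "controlled U * controlled V = controlled (U * V)"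
  using assms unfolding controlled_def
  by (subst mult_four_block_mat[of _ d d _ d _ d _ _ d _ d]) auto

lemma controlled_one: "controlled (1\<^sub>m d) = 1\<^sub>m (2 * d)"
  by (simp add: controlled_def mult_2)

lemma unitary_mat_controlled:
  assumes "unitary_mat d U"
  shows "unitary_mat (2 * d) (controlled U)"
proof (rule unitary_matI)
  note c = assms[THEN unitary_mat_carrier]
  then show "controlled U \<in> carrier_mat (2 * d) (2 * d)" by (simp add: controlled_carrier)
  show "mat_adjoint (controlled U) * controlled U = 1\<^sub>m (2 * d)"
    using c assms controlled_one[of d]
    by (simp add: controlled_adjoint[of _ d] controlled_mult[of _ d] unitary_mat_def)
qed

text \<open>Since the control qubit is the leading tensor factor, its value selects the upper or
  lower half of the vector. This links tensor notation with the block matrix that defines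
  \<open>controlled\<close>.\<close>

lemma kron_vec_unit_2:
  assumes "v \<in> carrier_vec d"
  shows "kron_vec (unit_vec 2 0) v = v @\<^sub>v 0\<^sub>v d" "kron_vec (unit_vec 2 1) v = 0\<^sub>v d @\<^sub>v v"
proof -
  have *: "i div d = 0 \<longleftrightarrow> i < d" "i div d = 1 \<longleftrightarrow> \<not> i < d" "\<not> i < d \<Longrightarrow> i mod d = i - d"
    if "i < 2 * d" for i
    using that by (auto simp: div_eq_0_iff mod_if div_if)
  show "kron_vec (unit_vec 2 0) v = v @\<^sub>v 0\<^sub>v d" "kron_vec (unit_vec 2 1) v = 0\<^sub>v d @\<^sub>v v"
    using assms * by (auto intro!: eq_vecI simp: kron_vec_index unit_vec_def less_mult_imp_div_less)
qed

lemma controlled_kron_vec: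
  assumes "U \<in> carrier_mat d d" "v \<in> carrier_vec d"
  shows "controlled U *\<^sub>v kron_vec (unit_vec 2 0) v = kron_vec (unit_vec 2 0) v"
    "controlled U *\<^sub>v kron_vec (unit_vec 2 1) v = kron_vec (unit_vec 2 1) (U *\<^sub>v v)"
proof -
  have "U *\<^sub>v v \<in> carrier_vec d" "U *\<^sub>v 0\<^sub>v d = 0\<^sub>v d" "0\<^sub>m d d *\<^sub>v v = 0\<^sub>v d"
      "0\<^sub>m d d *\<^sub>v 0\<^sub>v d = (0\<^sub>v d :: complex vec)"
    using assms by (auto intro!: eq_vecI simp: scalar_prod_def)
  then show "controlled U *\<^sub>v kron_vec (unit_vec 2 0) v = kron_vec (unit_vec 2 0) v"
    "controlled U *\<^sub>v kron_vec (unit_vec 2 1) v = kron_vec (unit_vec 2 1) (U *\<^sub>v v)"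
    using assms kron_vec_unit_2(2)[of "U *\<^sub>v v" d] kron_vec_unit_2(2)[of v d]
    by (simp_all add: kron_vec_unit_2(1) controlled_def four_block_mat_mult_vec[of _ d d _ d _ d])
qed

section \<open>Completion to a unitary; permutations, reflections and projections\<close>

text \<open>Complete \<open>g\<close> to a basis, orthogonalise it by Gram-Schmidt, which keeps the
  first vector, and use the normalised vectors as columns. This lets an arbitrary reference state be
  treated as basis state 0.\<close>

lemma unitary_mat_first_col:
  assumes g: "unit_state d g"
  obtains G where "unitary_mat d G" "G *\<^sub>v unit_vec d 0 = g"
proof -
  have gc: "g \<in> carrier_vec d" and g1: "g \<bullet>c g = 1" using g by (auto simp: unit_state_def)
  have g0: "g \<noteq> 0\<^sub>v d" using g1 by auto
  have d0: "0 < d" using gc g1 by (cases d) (auto simp: cscalar_prod_sum)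
  interpret cof_vec_space d "TYPE(complex)" .
  define b where "b = basis_completion g"
  define ws where "ws = gram_schmidt d b"
  note bc = basis_completion[OF gc g0, folded b_def]
  from bc(6,7) d0 obtain vs where bv: "b = g # vs" by (cases b) auto
  from gram_schmidt_result[OF bc(2,4,5) refl, folded ws_def]
  have ws: "set ws \<subseteq> carrier_vec d" "corthogonal ws" "length ws = d" by (auto simp: bc(6))
  have "hd ws = g" using gram_schmidt_hd[OF gc, of vs] bv ws_def by simp
  then have ws0: "ws ! 0 = g" using ws(3) d0 by (cases ws) auto
  have wc: "ws ! j \<in> carrier_vec d" if "j < d" for j using ws that by (metis nth_mem subsetD)
  \<comment> \<open>Gram-Schmidt only gives orthogonality here: \<open>c j\<close> is the squared
    norm of vector \<open>j\<close>, and division by its root makes the columns of \<open>G\<close>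
    orthonormal.\<close>
  define c where "c j = (\<Sum>i<d. (cmod (ws ! j $ i))\<^sup>2)" for j
  have self: "ws ! j \<bullet>c ws ! j = complex_of_real (c j)" if "j < d" for j
    using wc[OF that] by (simp add: cscalar_prod_sum c_def complex_norm_square flip: of_real_power)
  have orth: "ws ! i \<bullet>c ws ! j = 0 \<longleftrightarrow> i \<noteq> j" if "i < d" "j < d" for i j
    using ws that by (auto simp: corthogonal_def)
  have cpos: "0 < c j" if "j < d" for j
  proof -
    have "c j \<noteq> 0" using orth[OF that that] self[OF that] by auto
    moreover have "0 \<le> c j" by (simp add: c_def sum_nonneg)
    ultimately show ?thesis by simp
  qed
  define G where "G = mat d d (\<lambda>(i, j). ws ! j $ i / complex_of_real (sqrt (c j)))"
  have Gc: "G \<in> carrier_mat d d" by (simp add: G_def)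
  have "mat_adjoint G * G = 1\<^sub>m d"
  proof (rule eq_matI)
    fix i j assume "i < dim_row (1\<^sub>m d :: complex mat)" "j < dim_col (1\<^sub>m d :: complex mat)"
    then have ij: "i < d" "j < d" by auto
    have "(mat_adjoint G * G) $$ (i, j) =
        (\<Sum>k<d. ws ! j $ k * cnj (ws ! i $ k)) / (complex_of_real (sqrt (c i)) * complex_of_real (sqrt (c j)))"
      using ij by (simp add: G_def scalar_prod_def lessThan_atLeast0 sum_divide_distrib mult_ac)
    also have "(\<Sum>k<d. ws ! j $ k * cnj (ws ! i $ k)) = ws ! j \<bullet>c ws ! i"
      using carrier_vecD[OF wc[OF ij(1)]] by (simp add: cscalar_prod_sum)
    also have "\<dots> = (if i = j then complex_of_real (c i) else 0)"
      using self orth ij by auto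
    finally show "(mat_adjoint G * G) $$ (i, j) = 1\<^sub>m d $$ (i, j)"
      using ij cpos[of i] by (auto simp flip: of_real_mult)
  qed (auto simp: G_def)
  then have "unitary_mat d G" by (rule unitary_matI[OF Gc])
  \<comment> \<open>As \<open>g\<close> is a unit vector, normalisation leaves column 0
    unchanged.\<close>
  moreover have "complex_of_real (c 0) = 1" using self[OF d0] ws0 g1 by simp
  then have "G *\<^sub>v unit_vec d 0 = g"
    using d0 gc ws0 by (intro eq_vecI) (auto simp: G_def)
  ultimately show ?thesis by (rule that)
qed

definition perm_mat :: "nat \<Rightarrow> (nat \<Rightarrow> nat) \<Rightarrow> complex mat" where
  "perm_mat d \<pi> = mat d d (\<lambda>(i, j). if i = \<pi> j then 1 else 0)"

text \<open>For an involution, row \<open>i\<close> has its only 1 in column \<open>\<pi> i\<close>.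
  The permutations used below, transpositions and the copy map, are all involutions.\<close>

lemma perm_mat_mult_vec:
  assumes "\<And>j. j < d \<Longrightarrow> \<pi> j < d" "\<And>j. j < d \<Longrightarrow> \<pi> (\<pi> j) = j" "v \<in> carrier_vec d"
  shows "perm_mat d \<pi> *\<^sub>v v = vec d (\<lambda>i. v $ \<pi> i)"
proof (rule eq_vecI)
  fix i assume "i < dim_vec (vec d (\<lambda>i. v $ \<pi> i))"
  then have i: "i < d" by simp
  have "(perm_mat d \<pi> *\<^sub>v v) $ i = (\<Sum>j<d. if j = \<pi> i then v $ j else 0)"
    using i assms by (auto simp: perm_mat_def scalar_prod_def lessThan_atLeast0 simp del: sum.delta sum.delta'
        intro!: sum.cong)
  also have "\<dots> = v $ \<pi> i" using i assms by simp
  finally show "(perm_mat d \<pi> *\<^sub>v v) $ i = vec d (\<lambda>i. v $ \<pi> i) $ i" using i by simp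
qed (simp add: perm_mat_def)

lemma unitary_perm_mat:
  assumes "\<And>j. j < d \<Longrightarrow> \<pi> j < d" "\<And>j. j < d \<Longrightarrow> \<pi> (\<pi> j) = j"
  shows "unitary_mat d (perm_mat d \<pi>)"
proof (rule unitary_matI)
  show "mat_adjoint (perm_mat d \<pi>) * perm_mat d \<pi> = 1\<^sub>m d"
  proof (rule eq_matI)
    fix i j assume "i < dim_row (1\<^sub>m d :: complex mat)" "j < dim_col (1\<^sub>m d :: complex mat)"
    then have ij: "i < d" "j < d" by auto
    have "(mat_adjoint (perm_mat d \<pi>) * perm_mat d \<pi>) $$ (i, j)
        = (\<Sum>k<d. if k = \<pi> i then (if \<pi> i = \<pi> j then 1 else 0) else 0)"
      using ij assms by (auto simp: perm_mat_def scalar_prod_def lessThan_atLeast0 simp del: sum.delta sum.delta'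
        intro!: sum.cong)
    also have "\<dots> = (if \<pi> i = \<pi> j then 1 else 0)" using ij assms by simp
    also have "\<dots> = 1\<^sub>m d $$ (i, j)" using ij assms by (metis index_one_mat(1))
    finally show "(mat_adjoint (perm_mat d \<pi>) * perm_mat d \<pi>) $$ (i, j) = 1\<^sub>m d $$ (i, j)" .
  qed (auto simp: perm_mat_def)
qed (simp add: perm_mat_def)

definition sign_mat :: "nat \<Rightarrow> nat set \<Rightarrow> complex mat" where
  "sign_mat d S = mat d d (\<lambda>(i, j). if i = j then if i \<in> S then -1 else 1 else 0)"

lemma sign_mat_carrier: "sign_mat d S \<in> carrier_mat d d"
  by (simp add: sign_mat_def)

lemma sign_mat_mult_vec:
  assumes "v \<in> carrier_vec d"
  shows "sign_mat d S *\<^sub>v v = vec d (\<lambda>i. if i \<in> S then - v $ i else v $ i)"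
proof (rule eq_vecI)
  fix i assume "i < dim_vec (vec d (\<lambda>i. if i \<in> S then - v $ i else v $ i))"
  then have i: "i < d" by simp
  have "(sign_mat d S *\<^sub>v v) $ i = (\<Sum>j<d. if j = i then (if i \<in> S then - v $ i else v $ i) else 0)"
    using i assms by (auto simp: sign_mat_def scalar_prod_def lessThan_atLeast0 simp del: sum.delta sum.delta'
        intro!: sum.cong)
  then show "(sign_mat d S *\<^sub>v v) $ i = vec d (\<lambda>i. if i \<in> S then - v $ i else v $ i) $ i"
    using i by simp
qed (simp add: sign_mat_def)

lemma sign_mat_adjoint: "mat_adjoint (sign_mat d S) = sign_mat d S"
  by (rule eq_matI) (auto simp: sign_mat_def)

lemma unitary_sign_mat: "unitary_mat d (sign_mat d S)"
proof (rule unitary_matI)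
  show "mat_adjoint (sign_mat d S) * sign_mat d S = 1\<^sub>m d"
  proof (rule eq_matI)
    fix i j assume "i < dim_row (1\<^sub>m d :: complex mat)" "j < dim_col (1\<^sub>m d :: complex mat)"
    then have ij: "i < d" "j < d" by auto
    have "(mat_adjoint (sign_mat d S) * sign_mat d S) $$ (i, j) = (\<Sum>k<d. if k = i then (if i = j then 1 else 0) else 0)"
      using ij unfolding sign_mat_adjoint
      by (auto simp: sign_mat_def scalar_prod_def lessThan_atLeast0 simp del: sum.delta sum.delta'
        intro!: sum.cong)
    then show "(mat_adjoint (sign_mat d S) * sign_mat d S) $$ (i, j) = 1\<^sub>m d $$ (i, j)"
      using ij by simp
  qed (auto simp: sign_mat_def)
qed (rule sign_mat_carrier)

definition basis_proj :: "nat \<Rightarrow> nat \<Rightarrow> complex mat" where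
  "basis_proj d k = mat d d (\<lambda>(i, j). if i = k \<and> j = k then 1 else 0)"

lemma basis_proj_mult_vec:
  assumes "v \<in> carrier_vec d" "k < d"
  shows "basis_proj d k *\<^sub>v v = v $ k \<cdot>\<^sub>v unit_vec d k"
proof (rule eq_vecI)
  fix i assume "i < dim_vec (v $ k \<cdot>\<^sub>v unit_vec d k)"
  then have i: "i < d" by simp
  have "(basis_proj d k *\<^sub>v v) $ i = (\<Sum>j<d. if j = k then (if i = k then v $ k else 0) else 0)"
    using i assms by (auto simp: basis_proj_def scalar_prod_def lessThan_atLeast0 simp del: sum.delta sum.delta'
        intro!: sum.cong)
  then show "(basis_proj d k *\<^sub>v v) $ i = (v $ k \<cdot>\<^sub>v unit_vec d k) $ i"
    using i assms by (auto simp: unit_vec_def)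
qed (simp add: basis_proj_def)

lemma projective_measurement_basis_proj: "projective_measurement d d (basis_proj d)"
  unfolding projective_measurement_def
proof (intro conjI allI impI)
  fix k l assume kl: "k < d" "l < d"
  show "basis_proj d k \<in> carrier_mat d d" by (simp add: basis_proj_def)
  show "mat_adjoint (basis_proj d k) = basis_proj d k"
    by (rule eq_matI) (auto simp: basis_proj_def)
  show "basis_proj d k * basis_proj d l = (if k = l then basis_proj d k else 0\<^sub>m d d)"
  proof (rule eq_matI)
    fix i j assume "i < dim_row (if k = l then basis_proj d k else 0\<^sub>m d d)"
      "j < dim_col (if k = l then basis_proj d k else 0\<^sub>m d d)"
    then have ij: "i < d" "j < d" by (auto simp: basis_proj_def split: if_splits)
    have "(basis_proj d k * basis_proj d l) $$ (i, j) =
        (\<Sum>m<d. if m = k then (if i = k \<and> k = l \<and> j = l then 1 else 0) else 0)"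
      using ij by (auto simp: basis_proj_def scalar_prod_def lessThan_atLeast0 simp del: sum.delta sum.delta'
        intro!: sum.cong)
    then show "(basis_proj d k * basis_proj d l) $$ (i, j) =
        (if k = l then basis_proj d k else 0\<^sub>m d d) $$ (i, j)"
      using ij kl by (auto simp: basis_proj_def)
  qed (auto simp: basis_proj_def)
next
  show "mat d d (\<lambda>ij. \<Sum>k<d. basis_proj d k $$ ij) = 1\<^sub>m d"
  proof (rule eq_matI)
    fix i j assume "i < dim_row (1\<^sub>m d :: complex mat)" "j < dim_col (1\<^sub>m d :: complex mat)"
    then have ij: "i < d" "j < d" by auto
    have "(\<Sum>k<d. basis_proj d k $$ (i, j)) = (\<Sum>k<d. if k = i then (if i = j then 1 else 0) else 0)"
      using ij by (auto simp: basis_proj_def simp del: sum.delta sum.delta' intro!: sum.cong)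
    then show "mat d d (\<lambda>ij. \<Sum>k<d. basis_proj d k $$ ij) $$ (i, j) = 1\<^sub>m d $$ (i, j)"
      using ij by simp
  qed auto
qed

section \<open>One round of amplitude amplification\<close>

text \<open>The Born probability of an outcome in \<open>S\<close> when \<open>A\<close> is applied
  to basis state 0 and the result is measured in the computational basis.\<close>

definition success_prob :: "nat \<Rightarrow> nat set \<Rightarrow> complex mat \<Rightarrow> real" where
  "success_prob d S A = (\<Sum>j\<in>S. (cmod ((A *\<^sub>v unit_vec d 0) $ j))\<^sup>2)"

lemma unitary_first_col_norm:
  assumes "unitary_mat d A" "0 < d"
  shows "(\<Sum>i<d. (cmod ((A *\<^sub>v unit_vec d 0) $ i))\<^sup>2) = 1"
proof -
  have "A \<in> carrier_mat d d" using assms unitary_mat_carrier by blast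
  then have "(\<Sum>i<d. (cmod ((A *\<^sub>v unit_vec d 0) $ i))\<^sup>2) = Re ((A *\<^sub>v unit_vec d 0) \<bullet>c (A *\<^sub>v unit_vec d 0))"
    by (simp add: Re_cscalar_prod_self)
  also have "\<dots> = Re (unit_vec d 0 \<bullet>c unit_vec d 0)"
    using unitary_mat_cscalar_prod[OF assms(1)] by simp
  also have "\<dots> = (\<Sum>i<d. if i = 0 then 1 else 0)"
    unfolding Re_cscalar_prod_self by (auto simp: unit_vec_def simp del: sum.delta sum.delta' intro!: sum.cong)
  finally show ?thesis using assms(2) by simp
qed

lemma success_prob_bounds:
  assumes "unitary_mat d A" "0 < d" "S \<subseteq> {..<d}"
  shows "0 \<le> success_prob d S A" "success_prob d S A \<le> 1"
  using sum_mono2[OF finite_lessThan assms(3), of "\<lambda>j. (cmod ((A *\<^sub>v unit_vec d 0) $ j))\<^sup>2"]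
    unitary_first_col_norm[OF assms(1,2)]
  by (auto simp: success_prob_def intro!: sum_nonneg)

text \<open>Let a be the first column of \<open>A\<close>, and b the vector a with its entries in
  \<open>S\<close> negated. Conjugating the reflection at basis state 0 by \<open>A\<close> gives
  the reflection at a, so the new first column is b - 2 (1 - 2x) a, where x is the old success
  probability and 1 - 2x is the inner product of b and a. On \<open>S\<close>, where b = -a, this is
  (4x - 3) a.\<close>

lemma amplification_step:
  assumes A: "unitary_mat d A" and d: "0 < d" and S: "S \<subseteq> {..<d}"
  shows "success_prob d S (A * sign_mat d {0} * mat_adjoint A * sign_mat d S * A)
    = (3 - 4 * success_prob d S A)\<^sup>2 * success_prob d S A"
proof -
  define x where "x = success_prob d S A"
  define a where "a = A *\<^sub>v unit_vec d 0"
  define b where "b = sign_mat d S *\<^sub>v a"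
  define c where "c = mat_adjoint A *\<^sub>v b"
  have Ac: "A \<in> carrier_mat d d" using A unitary_mat_carrier by blast
  have car: "a \<in> carrier_vec d" "b \<in> carrier_vec d" "c \<in> carrier_vec d"
    using Ac sign_mat_carrier[of d S] by (auto simp: a_def b_def c_def mult_mat_vec_carrier[of _ d d])
  have bi: "b $ i = (if i \<in> S then - a $ i else a $ i)" if "i < d" for i
    using that car by (simp add: b_def sign_mat_mult_vec)
  have fin: "finite S" using S finite_subset by blast
  \<comment> \<open>Entry 0 of \<open>c\<close> is an inner product with basis state 0; moving the
    adjoint across turns it into the overlap of \<open>b\<close> with \<open>a\<close>.\<close>
  have "c $ 0 = c \<bullet>c unit_vec d 0"
    using d car(3) by (simp add: cscalar_prod_sum unit_vec_def if_distrib cong: if_cong)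
  also have "\<dots> = b \<bullet>c a"
    using cscalar_prod_mat_adjoint[of "mat_adjoint A" d d b "unit_vec d 0"] Ac car
    by (simp add: a_def c_def)
  also have "\<dots> = (\<Sum>i<d. complex_of_real ((cmod (a $ i))\<^sup>2) - (if i \<in> S then 2 * complex_of_real ((cmod (a $ i))\<^sup>2) else 0))"
    unfolding cscalar_prod_sum using car bi
    by (intro sum.cong) (auto simp: complex_norm_square simp del: of_real_power)
  also have "\<dots> = complex_of_real (1 - 2 * x)"
  proof -
    have "(\<Sum>i<d. if i \<in> S then 2 * complex_of_real ((cmod (a $ i))\<^sup>2) else 0)
        = 2 * complex_of_real x"
      using S by (simp add: sum.If_cases Int_absorb1 x_def success_prob_def a_def sum_distrib_left)
    moreover have "(\<Sum>i<d. complex_of_real ((cmod (a $ i))\<^sup>2)) = 1"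
      using unitary_first_col_norm[OF A d] unfolding a_def[symmetric]
      by (metis of_real_1 of_real_sum)
    ultimately show ?thesis by (simp add: sum_subtractf)
  qed
  finally have c0: "c $ 0 = complex_of_real (1 - 2 * x)" .
  \<comment> \<open>The reflection differs from the identity by a multiple of basis state 0, which
    \<open>A\<close> sends to \<open>a\<close>, while \<open>A\<close> sends \<open>c\<close> back
    to \<open>b\<close>.\<close>
  have "sign_mat d {0} *\<^sub>v c = c + (- 2 * c $ 0) \<cdot>\<^sub>v unit_vec d 0"
    using car(3) by (intro eq_vecI) (auto simp: sign_mat_mult_vec unit_vec_def)
  then have "A *\<^sub>v (sign_mat d {0} *\<^sub>v c) = A *\<^sub>v c + (- 2 * c $ 0) \<cdot>\<^sub>v a"
    using Ac car(3) by (simp add: mult_add_distrib_mat_vec[of _ d d] mult_mat_vec[of _ d d] a_def)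
  moreover have "A *\<^sub>v c = b"
    using A Ac car by (simp add: c_def unitary_mat_def flip: assoc_mult_mat_vec[of _ d d _ d])
  ultimately have "A *\<^sub>v (sign_mat d {0} *\<^sub>v c) = b + (- 2 * c $ 0) \<cdot>\<^sub>v a" by simp
  moreover have "(A * sign_mat d {0} * mat_adjoint A * sign_mat d S * A) *\<^sub>v unit_vec d 0
      = A *\<^sub>v (sign_mat d {0} *\<^sub>v c)"
    using Ac sign_mat_carrier[of d]
    by (simp add: a_def b_def c_def assoc_mult_mat_vec[of _ d d _ d] mult_carrier_mat[of _ d d _ d]
        mult_mat_vec_carrier[of _ d d])
  ultimately have "((A * sign_mat d {0} * mat_adjoint A * sign_mat d S * A) *\<^sub>v unit_vec d 0) $ j
      = complex_of_real (4 * x - 3) * a $ j" if "j \<in> S" for j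
    using that S car bi[of j] c0 by (auto simp: algebra_simps)
  then have "success_prob d S (A * sign_mat d {0} * mat_adjoint A * sign_mat d S * A)
      = (\<Sum>j\<in>S. (4 * x - 3)\<^sup>2 * (cmod (a $ j))\<^sup>2)"
    unfolding success_prob_def by (intro sum.cong) (auto simp: norm_mult power_mult_distrib simp del: of_real_diff of_real_mult)
  also have "\<dots> = (3 - 4 * x)\<^sup>2 * x"
    by (simp add: x_def success_prob_def a_def sum_distrib_left power2_commute)
  finally show ?thesis by (simp add: x_def)
qed

section \<open>Circuits and search programs\<close>

text \<open>Amplification needs the adjoint of a whole circuit. A \<open>program\<close> may contain
  measurements and so has no adjoint; a list of gates can be reversed gate by gate and converted to
  a program at the end by \<open>run\<close>.\<close>

datatype gate = Gate "complex mat" | Query oracle_id call_mode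

fun mode_adjoint :: "call_mode \<Rightarrow> call_mode" where
  "mode_adjoint Plain = Inverse"
| "mode_adjoint Inverse = Plain"
| "mode_adjoint Controlled = Controlled_Inverse"
| "mode_adjoint Controlled_Inverse = Controlled"

fun gate_adjoint :: "gate \<Rightarrow> gate" where
  "gate_adjoint (Gate V) = Gate (mat_adjoint V)"
| "gate_adjoint (Query orc c) = Query orc (mode_adjoint c)"

definition circuit_adjoint :: "gate list \<Rightarrow> gate list" where
  "circuit_adjoint gs = rev (map gate_adjoint gs)"

fun valid_gate :: "nat \<Rightarrow> gate \<Rightarrow> bool" where
  "valid_gate d (Gate V) \<longleftrightarrow> unitary_mat d V"
| "valid_gate d (Query orc c) \<longleftrightarrow> True"

definition valid_circuit :: "nat \<Rightarrow> gate list \<Rightarrow> bool" where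
  "valid_circuit d gs \<longleftrightarrow> (\<forall>g\<in>set gs. valid_gate d g)"

lemma valid_circuit_simps [simp]:
  "valid_circuit d []"
  "valid_circuit d (g # gs) \<longleftrightarrow> valid_gate d g \<and> valid_circuit d gs"
  "valid_circuit d (gs @ hs) \<longleftrightarrow> valid_circuit d gs \<and> valid_circuit d hs"
  by (auto simp: valid_circuit_def)

lemma valid_circuit_adjoint: "valid_circuit d gs \<Longrightarrow> valid_circuit d (circuit_adjoint gs)"
proof -
  have "valid_gate d g \<Longrightarrow> valid_gate d (gate_adjoint g)" for g
    by (cases g) (auto simp: unitary_mat_adjoint)
  then show "valid_circuit d gs \<Longrightarrow> valid_circuit d (circuit_adjoint gs)"
    by (auto simp: valid_circuit_def circuit_adjoint_def)
qed

fun gate_queries :: "gate \<Rightarrow> nat" where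
  "gate_queries (Gate V) = 0"
| "gate_queries (Query orc c) = 1"

definition circuit_queries :: "gate list \<Rightarrow> nat" where
  "circuit_queries gs = sum_list (map gate_queries gs)"

lemma circuit_queries_simps [simp]:
  "circuit_queries [] = 0"
  "circuit_queries (g # gs) = gate_queries g + circuit_queries gs"
  "circuit_queries (gs @ hs) = circuit_queries gs + circuit_queries hs"
  by (auto simp: circuit_queries_def)

lemma circuit_queries_adjoint [simp]: "circuit_queries (circuit_adjoint gs) = circuit_queries gs"
proof -
  have "gate_queries (gate_adjoint g) = gate_queries g" for g by (cases g) auto
  then show ?thesis by (simp add: circuit_queries_def circuit_adjoint_def rev_map[symmetric] o_def)
qed

fun run :: "gate list \<Rightarrow> program \<Rightarrow> program" where
  "run [] K = K"
| "run (Gate V # gs) K = Unitary V (run gs K)"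
| "run (Query orc c # gs) K = Call orc c (run gs K)"

lemma valid_program_run: "valid_program d (run gs K) \<longleftrightarrow> valid_circuit d gs \<and> valid_program d K"
  by (induction gs K rule: run.induct) auto

lemma calls_run: "calls (run gs K) = circuit_queries gs + calls K"
  by (induction gs K rule: run.induct) auto

text \<open>One round maps the first column \<open>a\<close> of the circuit to $(I - 2aa^*)R_S\,a$, where $R_S$
  flips the sign of the marked basis states; up to sign, this rotates by twice the angle of \<open>a\<close>.\<close>

primrec amplified :: "nat \<Rightarrow> nat set \<Rightarrow> gate list \<Rightarrow> nat \<Rightarrow> gate list" where
  "amplified d S A 0 = A"
| "amplified d S A (Suc k) = amplified d S A k @ [Gate (sign_mat d S)] @
     circuit_adjoint (amplified d S A k) @ [Gate (sign_mat d {0})] @ amplified d S A k"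

lemma circuit_queries_amplified: "circuit_queries (amplified d S A k) = 3 ^ k * circuit_queries A"
  by (induction k) auto

lemma valid_circuit_amplified: "valid_circuit d A \<Longrightarrow> valid_circuit d (amplified d S A k)"
  by (induction k) (auto simp: valid_circuit_adjoint unitary_sign_mat)

text \<open>Measuring in the computational basis tells the state after an unsuccessful run, so that
  exchanging the basis states 0 and \<open>j\<close> resets the system for the next run.\<close>

primrec search :: "nat \<Rightarrow> nat set \<Rightarrow> gate list list \<Rightarrow> program" where
  "search d S [] = Output True"
| "search d S (A # As) = run A (Measure d (basis_proj d)
     (\<lambda>j. if j \<in> S then Output False
           else Unitary (perm_mat d (Transposition.transpose 0 j)) (search d S As)))"

lemma transpose_less: "j < d \<Longrightarrow> i < d \<Longrightarrow> Transposition.transpose 0 j i < (d :: nat)"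
  by (auto simp: Transposition.transpose_def)

lemma valid_program_search:
  assumes "\<forall>A\<in>set As. valid_circuit d A" "0 < d"
  shows "valid_program d (search d S As)"
  using assms
  by (induction As)
    (auto simp: valid_program_run projective_measurement_basis_proj intro!: unitary_perm_mat transpose_less)

lemma calls_search:
  assumes "0 < d"
  shows "calls (search d S As) \<le> sum_list (map circuit_queries As)"
proof (induction As)
  case (Cons A As)
  \<comment> \<open>A marked outcome stops at no cost and every other outcome continues with the
    same circuits, so the maximum is bounded by the cost of the rest. Positive \<open>d\<close>
    keeps the set of outcomes nonempty.\<close>
  have "Max ((\<lambda>j. calls (if j \<in> S then Output False
      else Unitary (perm_mat d (Transposition.transpose 0 j)) (search d S As))) ` {..<d})
      \<le> sum_list (map circuit_queries As)"
    using assms Cons by (subst Max_le_iff) auto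
  then show ?case by (simp add: calls_run)
qed auto

section \<open>Matrices and output probabilities of circuits\<close>

text \<open>Here \<open>m\<close> is the dimension of the system that the oracles act on. Circuit
  semantics and amplification rest on unitarity of the oracles alone; their relation to
  \<open>p\<close> and \<open>q\<close> enters through marginals later.\<close>

locale oracles =
  fixes m dW :: nat and Up Uq :: "complex mat"
  assumes Up: "unitary_mat m Up" and Uq: "unitary_mat m Uq"
begin

abbreviation "D \<equiv> 2 * m * dW"

fun gate_mat :: "gate \<Rightarrow> complex mat" where
  "gate_mat (Gate V) = V"
| "gate_mat (Query orc c) = call_mat dW (case orc of Oracle_p \<Rightarrow> Up | Oracle_q \<Rightarrow> Uq) c"

text \<open>The head of the list acts first and is therefore the rightmost factor.\<close>

primrec circuit_mat :: "gate list \<Rightarrow> complex mat" where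
  "circuit_mat [] = 1\<^sub>m D"
| "circuit_mat (g # gs) = circuit_mat gs * gate_mat g"

lemma unitary_call_mat:
  assumes "unitary_mat m U"
  shows "unitary_mat D (call_mat dW U c)"
  using assms
  by (cases c) (auto simp: unitary_mat_one unitary_mat_adjoint intro!: unitary_mat_kron unitary_mat_controlled)

lemma unitary_gate_mat: "valid_gate D g \<Longrightarrow> unitary_mat D (gate_mat g)"
  using Up Uq by (cases g) (auto simp: unitary_call_mat split: oracle_id.split)

lemma unitary_circuit_mat: "valid_circuit D gs \<Longrightarrow> unitary_mat D (circuit_mat gs)"
  by (induction gs) (auto simp: unitary_mat_one intro!: unitary_mat_mult unitary_gate_mat)

lemmas circuit_mat_carrier = unitary_mat_carrier[OF unitary_circuit_mat]
lemmas gate_mat_carrier = unitary_mat_carrier[OF unitary_gate_mat]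

text \<open>The four call modes are closed under adjoints, so a circuit can be undone with as many
  calls as it makes.\<close>

lemma gate_mat_adjoint: "gate_mat (gate_adjoint g) = mat_adjoint (gate_mat g)"
proof (cases g)
  case (Query orc c)
  then show ?thesis
    using unitary_mat_carrier[OF Up] unitary_mat_carrier[OF Uq]
    by (cases c) (auto simp: kron_adjoint controlled_adjoint[of _ m] split: oracle_id.split)
qed simp

lemma circuit_mat_append:
  assumes "valid_circuit D gs" "valid_circuit D hs"
  shows "circuit_mat (gs @ hs) = circuit_mat hs * circuit_mat gs"
  using assms
proof (induction gs)
  case Nil
  then show ?case using circuit_mat_carrier[OF Nil(2)] by simp
next
  case (Cons g gs)
  then show ?case
    using circuit_mat_carrier[of hs] circuit_mat_carrier[of gs] gate_mat_carrier[of g]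
    by (simp add: assoc_mult_mat[of _ D D _ D _ D])
qed

lemma circuit_mat_adjoint:
  assumes "valid_circuit D gs"
  shows "circuit_mat (circuit_adjoint gs) = mat_adjoint (circuit_mat gs)"
  using assms
proof (induction gs)
  case (Cons g gs)
  have c: "gate_mat g \<in> carrier_mat D D" "circuit_mat gs \<in> carrier_mat D D"
    using Cons gate_mat_carrier circuit_mat_carrier by auto
  have v: "valid_circuit D (circuit_adjoint gs)" "valid_circuit D [gate_adjoint g]"
    using Cons(2) valid_circuit_adjoint[of D gs] valid_circuit_adjoint[of D "[g]"]
    by (auto simp: circuit_adjoint_def)
  have "circuit_mat (circuit_adjoint (g # gs)) = circuit_mat (circuit_adjoint gs @ [gate_adjoint g])"
    by (simp add: circuit_adjoint_def)
  also have "\<dots> = 1\<^sub>m D * mat_adjoint (gate_mat g) * mat_adjoint (circuit_mat gs)"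
    using v Cons by (simp add: circuit_mat_append gate_mat_adjoint)
  finally show ?case using c by (simp add: mat_adjoint_mult)
qed (simp add: circuit_adjoint_def)

lemma output_prob_run:
  assumes "valid_circuit D gs" "\<psi> \<in> carrier_vec D"
  shows "output_prob dW Up Uq b (run gs K) \<psi> = output_prob dW Up Uq b K (circuit_mat gs *\<^sub>v \<psi>)"
  using assms
proof (induction gs arbitrary: \<psi>)
  case (Cons g gs)
  have "output_prob dW Up Uq b (run (g # gs) K) \<psi> = output_prob dW Up Uq b (run gs K) (gate_mat g *\<^sub>v \<psi>)"
    by (cases g) auto
  then show ?case
    using Cons circuit_mat_carrier[of gs] gate_mat_carrier[of g]
    by (simp add: assoc_mult_mat_vec[of _ D D _ D] mult_mat_vec_carrier[of _ D D])
qed simp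

text \<open>With x the squared sine of an angle, the factor (3 - 4x)^2 x of
  \<open>amplification_step\<close> is the squared sine of three times that angle.\<close>

lemma sin_times_3: "sin (3 * x) = (3 - 4 * (sin x)\<^sup>2) * sin (x :: real)"
proof -
  have "sin (3 * x) = sin (2 * x + x)" by simp
  also have "\<dots> = 2 * sin x * (cos x)\<^sup>2 + (1 - 2 * (sin x)\<^sup>2) * sin x"
    unfolding sin_add sin_double cos_double_sin by (simp add: power2_eq_square)
  also have "\<dots> = (3 - 4 * (sin x)\<^sup>2) * sin x"
    unfolding cos_squared_eq by (simp add: algebra_simps)
  finally show ?thesis .
qed

lemma success_prob_amplified:
  assumes A: "valid_circuit D A" and D: "0 < D" and S: "S \<subseteq> {..<D}"
    and x: "success_prob D S (circuit_mat A) = (sin \<theta>)\<^sup>2"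
  shows "success_prob D S (circuit_mat (amplified D S A k)) = (sin (3 ^ k * \<theta>))\<^sup>2"
proof (induction k)
  case (Suc k)
  let ?B = "amplified D S A k"
  have B: "valid_circuit D ?B" using A by (rule valid_circuit_amplified)
  have c: "circuit_mat ?B \<in> carrier_mat D D" using B by (rule circuit_mat_carrier)
  note s = sign_mat_carrier[of D]
  have "circuit_mat (amplified D S A (Suc k)) =
    circuit_mat ?B * sign_mat D {0} * mat_adjoint (circuit_mat ?B) * sign_mat D S * circuit_mat ?B"
    using B c s
    by (simp add: circuit_mat_append circuit_mat_adjoint valid_circuit_adjoint unitary_sign_mat
        assoc_mult_mat[of _ D D _ D _ D] mult_carrier_mat[of _ D D _ D])
  then have "success_prob D S (circuit_mat (amplified D S A (Suc k)))
      = (3 - 4 * (sin (3 ^ k * \<theta>))\<^sup>2)\<^sup>2 * (sin (3 ^ k * \<theta>))\<^sup>2"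
    using amplification_step[OF unitary_circuit_mat[OF B] D S] Suc by simp
  also have "\<dots> = (sin (3 * (3 ^ k * \<theta>)))\<^sup>2"
    by (simp only: sin_times_3 power_mult_distrib)
  finally show ?case by (simp add: mult.assoc)
qed (use x in simp)

text \<open>The runs are independent: after an unmarked outcome the state is a multiple of a known
  basis state, and the swap returns it to basis state 0. States are not renormalised, so the scalar
  \<open>c\<close> carries the amplitude of the branch and the induction must allow it to
  vary.\<close>

lemma output_prob_search:
  assumes "\<forall>A\<in>set As. valid_circuit D A" "0 < D" "S \<subseteq> {..<D}"
  shows "output_prob dW Up Uq b (search D S As) (c \<cdot>\<^sub>v unit_vec D 0) = (cmod c)\<^sup>2 *
    (let fail = (\<Prod>A\<leftarrow>As. 1 - success_prob D S (circuit_mat A)) in if b then fail else 1 - fail)"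
  using assms(1)
proof (induction As arbitrary: c)
  case Nil
  have "Re ((c \<cdot>\<^sub>v unit_vec D 0) \<bullet>c (c \<cdot>\<^sub>v unit_vec D 0)) = (\<Sum>i<D. if i = 0 then (cmod c)\<^sup>2 else 0)"
    unfolding Re_cscalar_prod_self
    by (auto simp: unit_vec_def norm_mult simp del: sum.delta sum.delta' intro!: sum.cong)
  then show ?case using assms(2) by simp
next
  case (Cons A As)
  define \<psi> where "\<psi> = circuit_mat A *\<^sub>v unit_vec D 0"
  define fail where "fail = (\<Prod>A\<leftarrow>As. 1 - success_prob D S (circuit_mat A))"
  have A: "circuit_mat A \<in> carrier_mat D D" using Cons circuit_mat_carrier by simp
  have \<psi>: "\<psi> \<in> carrier_vec D" using A by (simp add: \<psi>_def mult_mat_vec_carrier[of _ D D])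
  have c\<psi>: "circuit_mat A *\<^sub>v (c \<cdot>\<^sub>v unit_vec D 0) = c \<cdot>\<^sub>v \<psi>"
    using A by (simp add: \<psi>_def mult_mat_vec[of _ D D])
  let ?K = "\<lambda>j. if j \<in> S then Output False
      else Unitary (perm_mat D (Transposition.transpose 0 j)) (search D S As)"
  \<comment> \<open>Outcome \<open>j\<close> contributes its weight times the output probability of
    what follows: a fixed verdict if \<open>j\<close> is marked, the induction hypothesis with
    scalar \<open>c * \<psi> $ j\<close> otherwise.\<close>
  have branch: "output_prob dW Up Uq b (?K j) (basis_proj D j *\<^sub>v (c \<cdot>\<^sub>v \<psi>)) =
     (cmod c)\<^sup>2 * ((cmod (\<psi> $ j))\<^sup>2 * (if j \<in> S then if b then 0 else 1 else if b then fail else 1 - fail))"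
    if j: "j < D" for j
  proof -
    have p: "basis_proj D j *\<^sub>v (c \<cdot>\<^sub>v \<psi>) = (c * \<psi> $ j) \<cdot>\<^sub>v unit_vec D j"
      using j \<psi> by (simp add: basis_proj_mult_vec)
    have "perm_mat D (Transposition.transpose 0 j) *\<^sub>v ((c * \<psi> $ j) \<cdot>\<^sub>v unit_vec D j)
        = vec D (\<lambda>i. ((c * \<psi> $ j) \<cdot>\<^sub>v unit_vec D j) $ Transposition.transpose 0 j i)"
      using j by (intro perm_mat_mult_vec) (auto intro!: transpose_less)
    also have "\<dots> = (c * \<psi> $ j) \<cdot>\<^sub>v unit_vec D 0"
      using j transpose_less[OF j]
      by (intro eq_vecI) (auto simp: unit_vec_def Transposition.transpose_def)
    finally have q: "perm_mat D (Transposition.transpose 0 j) *\<^sub>v ((c * \<psi> $ j) \<cdot>\<^sub>v unit_vec D j)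
        = (c * \<psi> $ j) \<cdot>\<^sub>v unit_vec D 0" .
    have "Re (((c * \<psi> $ j) \<cdot>\<^sub>v unit_vec D j) \<bullet>c ((c * \<psi> $ j) \<cdot>\<^sub>v unit_vec D j))
        = (\<Sum>i<D. if i = j then (cmod (c * \<psi> $ j))\<^sup>2 else 0)"
      unfolding Re_cscalar_prod_self
      by (auto simp: unit_vec_def norm_mult simp del: sum.delta sum.delta' intro!: sum.cong)
    then show ?thesis
      using p q Cons j by (simp add: norm_mult power_mult_distrib fail_def Let_def)
  qed
  define x where "x = success_prob D S (circuit_mat A)"
  have "output_prob dW Up Uq b (search D S (A # As)) (c \<cdot>\<^sub>v unit_vec D 0) =
      (\<Sum>j<D. output_prob dW Up Uq b (?K j) (basis_proj D j *\<^sub>v (c \<cdot>\<^sub>v \<psi>)))"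
    using Cons(2) by (simp add: output_prob_run c\<psi>)
  \<comment> \<open>All outcomes are first counted as unmarked, which gives total weight 1, and a
    correction is added on \<open>S\<close>, which gives the weight \<open>x\<close>.\<close>
  also have "\<dots> = (cmod c)\<^sup>2 * (\<Sum>j<D. (cmod (\<psi> $ j))\<^sup>2 * (if b then fail else 1 - fail)
      + (if j \<in> S then (cmod (\<psi> $ j))\<^sup>2 * (if b then - fail else fail) else 0))"
    unfolding sum_distrib_left by (intro sum.cong refl, subst branch) (auto simp: algebra_simps)
  also have "\<dots> = (cmod c)\<^sup>2 * ((if b then fail else 1 - fail) + x * (if b then - fail else fail))"
  proof -
    have "(\<Sum>j<D. (cmod (\<psi> $ j))\<^sup>2) = 1"
      using unitary_first_col_norm[OF unitary_circuit_mat assms(2)] Cons(2) by (simp add: \<psi>_def)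
    moreover have "(\<Sum>j<D. if j \<in> S then (cmod (\<psi> $ j))\<^sup>2 * (if b then - fail else fail) else 0)
        = x * (if b then - fail else fail)"
      using assms(3)
      by (simp add: sum.If_cases Int_absorb1 x_def success_prob_def \<psi>_def sum_distrib_right)
    ultimately show ?thesis by (simp add: sum.distrib flip: sum_distrib_right)
  qed
  also have "(if b then fail else 1 - fail) + x * (if b then - fail else fail)
      = (let fail = (\<Prod>A\<leftarrow>A # As. 1 - success_prob D S (circuit_mat A)) in if b then fail else 1 - fail)"
    by (simp add: fail_def x_def algebra_simps)
  finally show ?case .
qed

end

section \<open>Hadamard, NOT and copy gates on registers\<close>

lemma kron_vec_add:
  assumes "dim_vec u = dim_vec v"
  shows "kron_vec (u + v) w = kron_vec u w + kron_vec v w"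
  using assms by (intro eq_vecI) (auto simp: kron_vec_index div_mod_less_mult algebra_simps)

lemma kron_vec_smult: "kron_vec (c \<cdot>\<^sub>v u) w = c \<cdot>\<^sub>v kron_vec u w"
  by (intro eq_vecI) (auto simp: kron_vec_index div_mod_less_mult)

definition hadamard :: "complex mat" where
  "hadamard = mat 2 2 (\<lambda>(i, j). complex_of_real ((if i = 1 \<and> j = 1 then -1 else 1) / sqrt 2))"

definition pauli_x :: "complex mat" where
  "pauli_x = perm_mat 2 (Transposition.transpose 0 1)"

lemma lt_2_cases: "i < 2 \<longleftrightarrow> i = 0 \<or> i = (1 :: nat)" by auto

lemma unitary_hadamard: "unitary_mat 2 hadamard"
proof (rule unitary_matI)
  show "mat_adjoint hadamard * hadamard = 1\<^sub>m 2"
  proof (rule eq_matI)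
    fix i j assume "i < dim_row (1\<^sub>m 2 :: complex mat)" "j < dim_col (1\<^sub>m 2 :: complex mat)"
    then have "i = 0 \<or> i = 1" "j = 0 \<or> j = 1" by auto
    then show "(mat_adjoint hadamard * hadamard) $$ (i, j) = 1\<^sub>m 2 $$ (i, j)"
      by (auto simp: hadamard_def scalar_prod_def numeral_2_eq_2 simp flip: of_real_mult of_real_add)
  qed (auto simp: hadamard_def)
qed (simp add: hadamard_def)

lemma hadamard_mult_vec:
  assumes "c < 2"
  shows "hadamard *\<^sub>v unit_vec 2 c = complex_of_real (1 / sqrt 2) \<cdot>\<^sub>v unit_vec 2 0
    + complex_of_real ((if c = 0 then 1 else -1) / sqrt 2) \<cdot>\<^sub>v unit_vec 2 1"
  using assms by (intro eq_vecI) (auto simp: hadamard_def lt_2_cases)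

lemma unitary_pauli_x: "unitary_mat 2 pauli_x"
  unfolding pauli_x_def by (rule unitary_perm_mat) (auto intro!: transpose_less)

lemma pauli_x_mult_vec:
  "pauli_x *\<^sub>v unit_vec 2 0 = unit_vec 2 1" "pauli_x *\<^sub>v unit_vec 2 1 = unit_vec 2 0"
  unfolding pauli_x_def
  by (subst perm_mat_mult_vec; auto intro!: transpose_less eq_vecI simp: lt_2_cases)+

definition lift_ctrl :: "nat \<Rightarrow> nat \<Rightarrow> complex mat \<Rightarrow> complex mat" where
  "lift_ctrl d n V = kron (kron V (1\<^sub>m d)) (1\<^sub>m n)"

definition lift_main :: "nat \<Rightarrow> complex mat \<Rightarrow> complex mat" where
  "lift_main n G = kron (kron (1\<^sub>m 2) G) (1\<^sub>m n)"

lemma unitary_lift_ctrl: "unitary_mat 2 V \<Longrightarrow> unitary_mat (2 * d * n) (lift_ctrl d n V)"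
  unfolding lift_ctrl_def by (intro unitary_mat_kron unitary_mat_one)

lemma unitary_lift_main: "unitary_mat d G \<Longrightarrow> unitary_mat (2 * d * n) (lift_main n G)"
  unfolding lift_main_def by (intro unitary_mat_kron unitary_mat_one)

text \<open>Copies $|i\rangle|0\rangle$ to $|i\rangle|i\rangle$ by exchanging 0 and \<open>i\<close> in the workspace, which
  makes the copy an involution.\<close>

definition copy_perm :: "nat \<Rightarrow> nat \<Rightarrow> nat" where
  "copy_perm n j = j div n * n + Transposition.transpose 0 (j div n mod n) (j mod n)"

definition copy_mat :: "nat \<Rightarrow> nat \<Rightarrow> complex mat" where
  "copy_mat d n = perm_mat (2 * d * n) (copy_perm n)"

lemma copy_perm:
  assumes "0 < n"
  shows "copy_perm n j div n = j div n"
    "copy_perm n j mod n = Transposition.transpose 0 (j div n mod n) (j mod n)"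
    "copy_perm n (copy_perm n j) = j" "j < m * n \<Longrightarrow> copy_perm n j < m * n"
proof -
  have lt: "Transposition.transpose 0 (j div n mod n) (j mod n) < n"
    using assms by (intro transpose_less) auto
  show d: "copy_perm n j div n = j div n"
    and m: "copy_perm n j mod n = Transposition.transpose 0 (j div n mod n) (j mod n)"
    using lt by (auto simp: copy_perm_def)
  show "copy_perm n (copy_perm n j) = j"
    unfolding copy_perm_def[of n "copy_perm n j"] d m by simp
  show "copy_perm n j < m * n" if "j < m * n"
  proof -
    have "j div n < m" using that by (simp add: div_mod_less_mult)
    then have "Suc (j div n) * n \<le> m * n" by (intro mult_le_mono1) simp
    then show ?thesis using lt by (simp add: copy_perm_def)
  qed
qed

lemma unitary_copy_mat: "0 < n \<Longrightarrow> unitary_mat (2 * d * n) (copy_mat d n)"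
  unfolding copy_mat_def by (rule unitary_perm_mat) (auto simp: copy_perm)

definition reg :: "nat \<Rightarrow> nat \<Rightarrow> complex vec \<Rightarrow> nat \<Rightarrow> complex vec" where
  "reg n c v w = kron_vec (kron_vec (unit_vec 2 c) v) (unit_vec n w)"

lemma reg_carrier [simp]: "v \<in> carrier_vec d \<Longrightarrow> reg n c v w \<in> carrier_vec (2 * d * n)"
  unfolding reg_def by (intro kron_vec_carrier unit_vec_carrier)

lemma reg_dim [simp]: "dim_vec (reg n c v w) = 2 * dim_vec v * n"
  by (simp add: reg_def)

lemma reg_index:
  assumes "j < 2 * dim_vec v * n"
  shows "reg n c v w $ j =
    unit_vec 2 c $ (j div n div dim_vec v) * v $ (j div n mod dim_vec v) * unit_vec n w $ (j mod n)"
  using assms div_mod_less_mult[OF assms] by (simp add: reg_def kron_vec_index)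

lemma copy_mat_reg_cscalar_prod:
  assumes n: "0 < n" and dvd: "n dvd d" and y: "y \<in> carrier_vec d" "y' \<in> carrier_vec d"
    and c: "c < 2" "c' < 2" and w: "w < n"
  shows "(copy_mat d n *\<^sub>v reg n c y 0) \<bullet>c reg n c' y' w
    = (if c = c' then \<Sum>k<d. if k mod n = w then y $ k * cnj (y' $ k) else 0 else 0)"
proof -
  define f where "f r s = unit_vec 2 c $ (r div d) * y $ (r mod d)
      * (if Transposition.transpose 0 (r mod n) s = 0 then 1 else 0)
      * cnj (unit_vec 2 c' $ (r div d) * y' $ (r mod d) * (if s = w then 1 else 0))" for r s
  define h where "h a k = (if a = c then
      (if c = c' then if k mod n = w then y $ k * cnj (y' $ k) else 0 else 0) else 0)" for a k
  have dims: "dim_vec y = d" "dim_vec y' = d" using y by auto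
  have tr: "Transposition.transpose 0 (r mod n) s < n" if "s < n" for r s
    using that n by (intro transpose_less) auto
  have "(copy_mat d n *\<^sub>v reg n c y 0) \<bullet>c reg n c' y' w
      = (\<Sum>j<2*d*n. reg n c y 0 $ copy_perm n j * cnj (reg n c' y' w $ j))"
    unfolding copy_mat_def
    by (subst perm_mat_mult_vec) (use n y in \<open>auto simp: copy_perm cscalar_prod_sum intro!: sum.cong\<close>)
  also have "\<dots> = (\<Sum>j<(2*d)*n. f (j div n) (j mod n))"
  proof (intro sum.cong refl)
    fix j assume "j \<in> {..<2*d*n}"
    then have j: "j < 2 * d * n" by simp
    have j': "copy_perm n j < 2 * d * n" using copy_perm(4)[OF n j] .
    show "reg n c y 0 $ copy_perm n j * cnj (reg n c' y' w $ j) = f (j div n) (j mod n)"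
      using j j' n w tr[of "j mod n" "j div n"]
      by (simp add: reg_index dims copy_perm f_def div_mod_less_mult[OF j] unit_vec_def)
  qed
  also have "\<dots> = (\<Sum>r<2*d. \<Sum>s<n. f r s)" by (rule sum_div_mod)
  also have "\<dots> = (\<Sum>r<2*d. h (r div d) (r mod d))"
  proof (intro sum.cong refl)
    fix r assume "r \<in> {..<2*d}"
    then have r: "r < 2 * d" by simp
    \<comment> \<open>Removing the control qubit from the index does not change the \<open>B\<close>
      component.\<close>
    have m: "r mod d mod n = r mod n" using dvd by (rule mod_mod_cancel)
    have t: "Transposition.transpose 0 (r mod n) w = 0 \<longleftrightarrow> r mod n = w"
      by (auto simp: Transposition.transpose_def)
    have "(\<Sum>s<n. f r s) = (\<Sum>s<n. if s = w then f r w else 0)"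
      by (auto simp: f_def simp del: sum.delta sum.delta' intro!: sum.cong)
    also have "\<dots> = h (r div d) (r mod d)"
      using w t m c div_mod_less_mult[OF r] by (auto simp: f_def h_def unit_vec_def)
    finally show "(\<Sum>s<n. f r s) = h (r div d) (r mod d)" .
  qed
  also have "\<dots> = (\<Sum>a<2. \<Sum>k<d. h a k)" by (rule sum_div_mod)
  also have "\<dots> = (\<Sum>a<2. if a = c then (if c = c' then \<Sum>k<d. if k mod n = w then y $ k * cnj (y' $ k) else 0 else 0) else 0)"
    by (intro sum.cong refl) (auto simp: h_def)
  also have "\<dots> = (if c = c' then \<Sum>k<d. if k mod n = w then y $ k * cnj (y' $ k) else 0 else 0)"
    using c by simp
  finally show ?thesis .
qed

section \<open>The difference circuit and its success probability\<close>

text \<open>The entries with \<open>B\<close> component \<open>w\<close> form the vector \<phi>_w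
  scaled by the square root of \<open>p w\<close>. As \<phi>_w is a unit vector, its choice drops
  out of the squared norm.\<close>

lemma purified_oracle_marginal:
  assumes "purified_oracle dA n a0 b0 p U" "distribution n p" "w < n"
  shows "(\<Sum>k<dA * n. if k mod n = w then (U *\<^sub>v kron_vec a0 b0) $ k * cnj ((U *\<^sub>v kron_vec a0 b0) $ k) else 0)
    = complex_of_real (p w)"
proof -
  from assms(1) obtain \<phi> where
    \<phi>': "\<forall>i<n. \<phi> i \<in> carrier_vec dA" "\<forall>i<n. \<forall>j<n. \<phi> i \<bullet>c \<phi> j = (if i = j then 1 else 0)"
    and U: "U *\<^sub>v kron_vec a0 b0 =
      vec (dA * n) (\<lambda>k. \<Sum>i<n. complex_of_real (sqrt (p i)) * kron_vec (\<phi> i) (unit_vec n i) $ k)"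
    unfolding purified_oracle_def by blast
  then have \<phi>: "\<And>i. i < n \<Longrightarrow> \<phi> i \<in> carrier_vec dA" "\<And>i. i < n \<Longrightarrow> \<phi> i \<bullet>c \<phi> i = 1"
    by auto
  have idx: "(U *\<^sub>v kron_vec a0 b0) $ k = complex_of_real (sqrt (p (k mod n))) * \<phi> (k mod n) $ (k div n)"
    if k: "k < dA * n" for k
  proof -
    have "(U *\<^sub>v kron_vec a0 b0) $ k =
        (\<Sum>i<n. if i = k mod n then complex_of_real (sqrt (p (k mod n))) * \<phi> (k mod n) $ (k div n) else 0)"
      unfolding U using k \<phi>(1)[THEN carrier_vecD] div_mod_less_mult[OF k]
      by (auto simp: kron_vec_index unit_vec_def simp del: sum.delta sum.delta' intro!: sum.cong)
    then show ?thesis using div_mod_less_mult[OF k] by simp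
  qed
  have pw: "0 \<le> p w" using assms by (simp add: distribution_def)
  have "(\<Sum>k<dA * n. if k mod n = w then (U *\<^sub>v kron_vec a0 b0) $ k * cnj ((U *\<^sub>v kron_vec a0 b0) $ k) else 0)
    = (\<Sum>k<dA * n. (\<lambda>a b. if b = w then complex_of_real (p w) * (\<phi> w $ a * cnj (\<phi> w $ a)) else 0) (k div n) (k mod n))"
    using pw by (intro sum.cong) (auto simp: idx mult_ac simp flip: of_real_mult)
  also have "\<dots> = (\<Sum>a<dA. \<Sum>b<n. if b = w then complex_of_real (p w) * (\<phi> w $ a * cnj (\<phi> w $ a)) else 0)"
    by (rule sum_div_mod)
  also have "\<dots> = complex_of_real (p w) * (\<phi> w \<bullet>c \<phi> w)"
    using assms(3) \<phi>(1)[OF assms(3)] by (simp add: cscalar_prod_sum sum_distrib_left)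
  finally show ?thesis using \<phi>(2)[OF assms(3)] by simp
qed

text \<open>On control 0 the target is the superposition of |0> U_p g and |1> U_q g with equal
  weights, where g is the image of basis state 0 under \<open>G\<close>. Conjugation by
  \<open>pauli_x\<close> makes the controlled call to the first oracle act on control value
  0.\<close>

definition prepare :: "nat \<Rightarrow> nat \<Rightarrow> complex mat \<Rightarrow> gate list" where
  "prepare d n G = [Gate (lift_main n G), Gate (lift_ctrl d n hadamard),
     Gate (lift_ctrl d n pauli_x), Query Oracle_p Controlled,
     Gate (lift_ctrl d n pauli_x), Query Oracle_q Controlled]"

definition difference_circuit :: "nat \<Rightarrow> nat \<Rightarrow> complex mat \<Rightarrow> gate list" where
  "difference_circuit d n G =
     prepare d n G @ [Gate (copy_mat d n)] @ circuit_adjoint (prepare d n G)"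

lemma valid_prepare: "unitary_mat d G \<Longrightarrow> valid_circuit (2 * d * n) (prepare d n G)"
  by (simp add: prepare_def unitary_lift_ctrl unitary_lift_main unitary_hadamard unitary_pauli_x)

lemma valid_difference_circuit:
  "unitary_mat d G \<Longrightarrow> 0 < n \<Longrightarrow> valid_circuit (2 * d * n) (difference_circuit d n G)"
  by (simp add: difference_circuit_def valid_prepare valid_circuit_adjoint unitary_copy_mat)

lemma circuit_queries_difference_circuit: "circuit_queries (difference_circuit d n G) = 4"
  by (simp add: difference_circuit_def prepare_def)

lemma lift_main_reg:
  assumes "G \<in> carrier_mat d d" "v \<in> carrier_vec d"
  shows "lift_main n G *\<^sub>v reg n c v w = reg n c (G *\<^sub>v v) w"
  using assms by (simp add: lift_main_def reg_def kron_mult_vec)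

context oracles
begin

text \<open>Both control values are needed: 0 for the initial state and 1 for the marked states,
  against which the outcome is tested. The Hadamard gate supplies the minus sign for control
  1.\<close>

lemma prepare_mult_vec:
  assumes G: "unitary_mat m G" and c: "c < 2"
  shows "circuit_mat (prepare m dW G) *\<^sub>v reg dW c (unit_vec m 0) w =
    complex_of_real (1 / sqrt 2) \<cdot>\<^sub>v reg dW 0 (Up *\<^sub>v (G *\<^sub>v unit_vec m 0)) w +
    complex_of_real ((if c = 0 then 1 else -1) / sqrt 2) \<cdot>\<^sub>v reg dW 1 (Uq *\<^sub>v (G *\<^sub>v unit_vec m 0)) w"
proof -
  define g where "g = G *\<^sub>v unit_vec m 0"
  have carr: "G \<in> carrier_mat m m" "Up \<in> carrier_mat m m" "Uq \<in> carrier_mat m m"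
    using G Up Uq unitary_mat_carrier by auto
  have g: "g \<in> carrier_vec m" "Up *\<^sub>v g \<in> carrier_vec m" "Uq *\<^sub>v g \<in> carrier_vec m"
    using carr by (auto simp: g_def mult_mat_vec_carrier[of _ m m])
  define X where "X = lift_ctrl m dW pauli_x"
  define H where "H = lift_ctrl m dW hadamard"
  define CP where "CP = kron (controlled Up) (1\<^sub>m dW)"
  define CQ where "CQ = kron (controlled Uq) (1\<^sub>m dW)"
  have mats: "lift_main dW G \<in> carrier_mat D D" "X \<in> carrier_mat D D" "H \<in> carrier_mat D D"
    "CP \<in> carrier_mat D D" "CQ \<in> carrier_mat D D"
    using unitary_mat_carrier[OF unitary_lift_main[OF G]]
      unitary_mat_carrier[OF unitary_lift_ctrl[OF unitary_pauli_x]]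
      unitary_mat_carrier[OF unitary_lift_ctrl[OF unitary_hadamard]]
      unitary_mat_carrier[OF unitary_call_mat[OF Up, of Controlled]]
      unitary_mat_carrier[OF unitary_call_mat[OF Uq, of Controlled]]
    by (auto simp: X_def H_def CP_def CQ_def)
  have lin: "M *\<^sub>v (\<alpha> \<cdot>\<^sub>v reg dW i u w + \<beta> \<cdot>\<^sub>v reg dW j v w)
      = \<alpha> \<cdot>\<^sub>v (M *\<^sub>v reg dW i u w) + \<beta> \<cdot>\<^sub>v (M *\<^sub>v reg dW j v w)"
    if "M \<in> carrier_mat D D" "u \<in> carrier_vec m" "v \<in> carrier_vec m" for M \<alpha> \<beta> i j u v
    using that by (simp add: mult_add_distrib_mat_vec[of _ D D] mult_mat_vec[of _ D D])
  have X: "X *\<^sub>v reg dW 0 v w = reg dW 1 v w" "X *\<^sub>v reg dW 1 v w = reg dW 0 v w"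
    if "v \<in> carrier_vec m" for v
    using that pauli_x_mult_vec unitary_mat_carrier[OF unitary_pauli_x]
    by (auto simp: X_def lift_ctrl_def reg_def kron_mult_vec)
  have CP: "CP *\<^sub>v reg dW 0 v w = reg dW 0 v w" "CP *\<^sub>v reg dW 1 v w = reg dW 1 (Up *\<^sub>v v) w"
    if "v \<in> carrier_vec m" for v
    using that carr controlled_kron_vec[of Up m v] controlled_carrier[of Up m]
    by (auto simp: CP_def reg_def kron_mult_vec)
  have CQ: "CQ *\<^sub>v reg dW 0 v w = reg dW 0 v w" "CQ *\<^sub>v reg dW 1 v w = reg dW 1 (Uq *\<^sub>v v) w"
    if "v \<in> carrier_vec m" for v
    using that carr controlled_kron_vec[of Uq m v] controlled_carrier[of Uq m]
    by (auto simp: CQ_def reg_def kron_mult_vec)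
  define \<alpha> where "\<alpha> = complex_of_real (1 / sqrt 2)"
  define \<beta> where "\<beta> = complex_of_real ((if c = 0 then 1 else -1) / sqrt 2)"
  have H: "H *\<^sub>v reg dW c g w = \<alpha> \<cdot>\<^sub>v reg dW 0 g w + \<beta> \<cdot>\<^sub>v reg dW 1 g w"
    using g unitary_mat_carrier[OF unitary_hadamard]
    by (simp add: H_def lift_ctrl_def reg_def kron_mult_vec hadamard_mult_vec[OF c] kron_vec_add
        kron_vec_smult \<alpha>_def \<beta>_def)
  have "circuit_mat (prepare m dW G) *\<^sub>v reg dW c (unit_vec m 0) w
      = CQ *\<^sub>v (X *\<^sub>v (CP *\<^sub>v (X *\<^sub>v (H *\<^sub>v (lift_main dW G *\<^sub>v reg dW c (unit_vec m 0) w)))))"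
    using mats
    by (simp add: prepare_def X_def[symmetric] H_def[symmetric] CP_def[symmetric] CQ_def[symmetric]
        assoc_mult_mat_vec[of _ D D _ D] mult_carrier_mat[of _ D D _ D] mult_mat_vec_carrier[of _ D D])
  also have "\<dots> = CQ *\<^sub>v (X *\<^sub>v (CP *\<^sub>v (X *\<^sub>v (\<alpha> \<cdot>\<^sub>v reg dW 0 g w + \<beta> \<cdot>\<^sub>v reg dW 1 g w))))"
    using carr by (simp add: lift_main_reg[of _ m] H flip: g_def)
  also have "\<dots> = \<alpha> \<cdot>\<^sub>v reg dW 0 (Up *\<^sub>v g) w + \<beta> \<cdot>\<^sub>v reg dW 1 (Uq *\<^sub>v g) w"
    using g by (simp add: lin mats X CP CQ del: One_nat_def)
  finally show ?thesis by (simp add: \<alpha>_def \<beta>_def g_def)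
qed

end

lemma cscalar_prod_bilinear:
  fixes u v x y :: "complex vec"
  assumes "u \<in> carrier_vec d" "v \<in> carrier_vec d" "x \<in> carrier_vec d" "y \<in> carrier_vec d"
  shows "(a \<cdot>\<^sub>v u + b \<cdot>\<^sub>v v) \<bullet>c (s \<cdot>\<^sub>v x + t \<cdot>\<^sub>v y) =
    a * cnj s * (u \<bullet>c x) + a * cnj t * (u \<bullet>c y) + b * cnj s * (v \<bullet>c x) + b * cnj t * (v \<bullet>c y)"
  using assms
  by (simp add: cscalar_prod_sum algebra_simps sum.distrib sum_distrib_left)

lemma unit_state_pos: "unit_state d g \<Longrightarrow> 0 < d"
  by (rule ccontr) (auto simp: unit_state_def scalar_prod_def)

lemma unit_state_kron_vec:
  assumes "unit_state a u" "unit_state b v"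
  shows "unit_state (a * b) (kron_vec u v)"
proof -
  have uv: "u \<in> carrier_vec a" "v \<in> carrier_vec b" "u \<bullet>c u = 1" "v \<bullet>c v = 1"
    using assms by (auto simp: unit_state_def)
  have "kron_vec u v \<bullet>c kron_vec u v = (\<Sum>i<a * b.
     (\<lambda>k l. (u $ k * cnj (u $ k)) * (v $ l * cnj (v $ l))) (i div b) (i mod b))"
    using uv by (auto simp: cscalar_prod_sum kron_vec_index intro!: sum.cong)
  also have "\<dots> = (\<Sum>k<a. \<Sum>l<b. (u $ k * cnj (u $ k)) * (v $ l * cnj (v $ l)))"
    by (rule sum_div_mod)
  also have "\<dots> = (u \<bullet>c u) * (v \<bullet>c v)"
    using uv by (simp add: cscalar_prod_sum flip: sum_product)
  finally show ?thesis using uv by (auto simp: unit_state_def)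
qed

lemma reg_unit_vec:
  assumes "c < 2" "0 < d" "w < n"
  shows "reg n c (unit_vec d 0) w = unit_vec (2 * d * n) (c * d * n + w)"
  using assms kron_vec_unit[of "c * d" "2 * d" w n] by (simp add: reg_def kron_vec_unit)

lemma (in oracles) success_prob_difference_circuit:
  assumes G: "unitary_mat m G" and n: "0 < dW" "dW dvd m" "0 < m"
    and p: "\<And>w. w < dW \<Longrightarrow> (\<Sum>k<m. if k mod dW = w then
      (Up *\<^sub>v (G *\<^sub>v unit_vec m 0)) $ k * cnj ((Up *\<^sub>v (G *\<^sub>v unit_vec m 0)) $ k) else 0) = complex_of_real (p w)"
    and q: "\<And>w. w < dW \<Longrightarrow> (\<Sum>k<m. if k mod dW = w then
      (Uq *\<^sub>v (G *\<^sub>v unit_vec m 0)) $ k * cnj ((Uq *\<^sub>v (G *\<^sub>v unit_vec m 0)) $ k) else 0) = complex_of_real (q w)"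
  shows "success_prob D {m * dW..<m * dW + dW} (circuit_mat (difference_circuit m dW G))
    = (\<Sum>w<dW. (p w - q w)\<^sup>2) / 4"
proof -
  let ?A = "circuit_mat (difference_circuit m dW G)" and ?F = "circuit_mat (prepare m dW G)"
  let ?C = "copy_mat m dW"
  define P where "P = Up *\<^sub>v (G *\<^sub>v unit_vec m 0)"
  define Q where "Q = Uq *\<^sub>v (G *\<^sub>v unit_vec m 0)"
  have PQ: "P \<in> carrier_vec m" "Q \<in> carrier_vec m"
    using unitary_mat_carrier[OF G] unitary_mat_carrier[OF Up] unitary_mat_carrier[OF Uq]
    by (auto simp: P_def Q_def mult_mat_vec_carrier[of _ m m])
  have F: "?F \<in> carrier_mat D D" using circuit_mat_carrier[OF valid_prepare[OF G]] .
  have C: "?C \<in> carrier_mat D D" using unitary_mat_carrier[OF unitary_copy_mat[OF n(1)]] .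
  have A: "?A = mat_adjoint ?F * ?C * ?F"
    using valid_prepare[OF G, of dW] unitary_copy_mat[OF n(1), of m] F C
    by (simp add: difference_circuit_def circuit_mat_append circuit_mat_adjoint valid_circuit_adjoint
        assoc_mult_mat[of _ D D _ D _ D])
  have "(?A *\<^sub>v unit_vec D 0) $ (m * dW + w) = complex_of_real ((p w - q w) / 2)" if w: "w < dW" for w
  proof -
    let ?r = "complex_of_real (1 / sqrt 2)"
    let ?i = "reg dW 0 (unit_vec m 0) 0" and ?o = "reg dW 1 (unit_vec m 0) w"
    have i: "?i = unit_vec D 0" using n by (simp add: reg_unit_vec)
    have o: "?o = unit_vec D (m * dW + w)" using n w reg_unit_vec[of 1 m w dW] by simp
    have mw: "m * dW + w < D"
      using n w by (simp add: mult_2 add_mult_distrib less_le_trans[OF w])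
    have Fi: "?F *\<^sub>v ?i = ?r \<cdot>\<^sub>v reg dW 0 P 0 + ?r \<cdot>\<^sub>v reg dW 1 Q 0"
      using prepare_mult_vec[OF G, of 0] by (simp add: P_def Q_def)
    have Fo: "?F *\<^sub>v ?o = ?r \<cdot>\<^sub>v reg dW 0 P w + (- ?r) \<cdot>\<^sub>v reg dW 1 Q w"
      using prepare_mult_vec[OF G, of 1] by (simp add: P_def Q_def)
    have CFi: "?C *\<^sub>v (?F *\<^sub>v ?i) = ?r \<cdot>\<^sub>v (?C *\<^sub>v reg dW 0 P 0) + ?r \<cdot>\<^sub>v (?C *\<^sub>v reg dW 1 Q 0)"
      unfolding Fi using C PQ by (simp add: mult_add_distrib_mat_vec[of _ D D] mult_mat_vec[of _ D D])
    have "(?A *\<^sub>v unit_vec D 0) $ (m * dW + w) = (?A *\<^sub>v ?i) \<bullet>c ?o"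
      unfolding i o using mw by (simp add: cscalar_prod_sum unit_vec_def if_distrib cong: if_cong)
    also have "?A *\<^sub>v ?i = mat_adjoint ?F *\<^sub>v (?C *\<^sub>v (?F *\<^sub>v ?i))"
      unfolding A i using F C
      by (simp add: assoc_mult_mat_vec[of _ D D _ D] mult_carrier_mat[of _ D D _ D] mult_mat_vec_carrier[of _ D D])
    \<comment> \<open>Moving the uncomputation to the other side leaves an inner product of two
      prepared states with one copy in between.\<close>
    also have "(mat_adjoint ?F *\<^sub>v (?C *\<^sub>v (?F *\<^sub>v ?i))) \<bullet>c ?o = (?C *\<^sub>v (?F *\<^sub>v ?i)) \<bullet>c (?F *\<^sub>v ?o)"
      using cscalar_prod_mat_adjoint[of "mat_adjoint ?F" D D "?C *\<^sub>v (?F *\<^sub>v ?i)" ?o] F C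
      by (simp add: mult_mat_vec_carrier[of _ D D])
    also have "\<dots> = ?r * ?r * complex_of_real (p w) - ?r * ?r * complex_of_real (q w)"
      unfolding CFi Fo
      using C PQ w n p[OF w] q[OF w]
      by (subst cscalar_prod_bilinear[of _ D])
        (auto simp: mult_mat_vec_carrier[of _ D D] copy_mat_reg_cscalar_prod[of dW m] P_def Q_def)
    also have "?r * ?r = 1 / 2" by (simp flip: of_real_mult)
    finally show ?thesis by simp
  qed
  then have "success_prob D {m * dW..<m * dW + dW} ?A = (\<Sum>w<dW. ((p w - q w) / 2)\<^sup>2)"
    using sum.shift_bounds_nat_ivl[of "\<lambda>j. (cmod ((?A *\<^sub>v unit_vec D 0) $ j))\<^sup>2" 0 "m * dW" dW]
    by (simp add: success_prob_def add.commute lessThan_atLeast0 power_divide del: of_real_divide of_real_diff)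
  then show ?thesis by (simp add: power_divide sum_divide_distrib)
qed

section \<open>Number of rounds and repetitions\<close>

text \<open>Take the least \<open>k\<close> for which the tripled angle reaches pi/6. One tripling
  earlier it was below pi/6, so it cannot exceed pi/2, and the sine is monotone up to there with
  value 1/2 at pi/6.\<close>

lemma exists_good_angle:
  fixes \<theta> :: real
  assumes "0 \<le> \<theta>" "\<theta> \<le> pi / 2" "pi / 6 \<le> 3 ^ K * \<theta>"
  shows "\<exists>k\<le>K. 1 / 4 \<le> (sin (3 ^ k * \<theta>))\<^sup>2"
proof -
  define k where "k = (LEAST k. pi / 6 \<le> 3 ^ k * \<theta>)"
  have k: "pi / 6 \<le> 3 ^ k * \<theta>" "k \<le> K"
    unfolding k_def using assms by (auto intro: LeastI Least_le)
  have "3 ^ k * \<theta> \<le> pi / 2"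
  proof (cases k)
    case (Suc l)
    then have "\<not> pi / 6 \<le> 3 ^ l * \<theta>" unfolding k_def using not_less_Least by (metis lessI)
    then show ?thesis using Suc by simp
  qed (use assms in simp)
  then have "sin (pi / 6) \<le> sin (3 ^ k * \<theta>)" using k by (intro sin_monotone_2pi_le) auto
  then have "(1 / 2)\<^sup>2 \<le> (sin (3 ^ k * \<theta>))\<^sup>2" by (intro power_mono) (auto simp: sin_30)
  then show ?thesis using k(2) by (auto simp: power2_eq_square)
qed

definition rounds :: "real \<Rightarrow> nat" where
  "rounds r = (LEAST K. r \<le> 3 ^ K)"

text \<open>Minimality of the exponent costs at most one factor 3. For exponent 0 the second bound
  reads 1 \<le> 3 r, which follows from the hypothesis.\<close>

lemma rounds:
  assumes "1 \<le> r"
  shows "r \<le> 3 ^ rounds r" "3 ^ rounds r \<le> 3 * r"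
proof -
  obtain K where "r < 3 ^ K" using real_arch_pow[of 3 r] by auto
  then have "r \<le> 3 ^ K" by simp
  then show "r \<le> 3 ^ rounds r" unfolding rounds_def by (rule LeastI)
  show "3 ^ rounds r \<le> 3 * r"
  proof (cases "rounds r")
    case (Suc l)
    then have "\<not> r \<le> 3 ^ l" unfolding rounds_def using not_less_Least by (metis lessI)
    then show ?thesis using Suc by simp
  qed (use assms in simp)
qed

text \<open>Four repetitions, because four independent runs with success probability at least 1/4
  all fail with probability at most (3/4)^4 = 81/256 < 1/3.\<close>

definition schedule :: "(nat \<Rightarrow> 'a) \<Rightarrow> nat \<Rightarrow> 'a list" where
  "schedule f N = concat (map (\<lambda>k. replicate 4 (f k)) [0..<N])"

lemma prod_list_schedule: "(\<Prod>x\<leftarrow>schedule f N. h x) = (\<Prod>k<N. (h (f k) :: real) ^ 4)"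
  by (induction N) (auto simp: schedule_def numeral_eq_Suc)

lemma sum_list_schedule: "(\<Sum>x\<leftarrow>schedule f N. h x) = (\<Sum>k<N. 4 * (h (f k) :: nat))"
  by (induction N) (auto simp: schedule_def numeral_eq_Suc)

lemma set_schedule: "x \<in> set (schedule f N) \<Longrightarrow> \<exists>k. x = f k"
  by (auto simp: schedule_def)

text \<open>Bounds the probability that all runs fail by the factor of the one good number of
  rounds: the other runs can only decrease it.\<close>

lemma prod_le_factor:
  fixes f :: "nat \<Rightarrow> real"
  assumes "k < N" "\<And>i. i < N \<Longrightarrow> 0 \<le> f i" "\<And>i. i < N \<Longrightarrow> f i \<le> 1"
  shows "(\<Prod>i<N. f i) \<le> f k"
proof -
  have "(\<Prod>i<N. f i) = f k * (\<Prod>i\<in>{..<N} - {k}. f i)" using assms(1) by (intro prod.remove) auto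
  also have "\<dots> \<le> f k * 1" using assms by (intro mult_left_mono prod_le_1) auto
  finally show ?thesis by simp
qed

section \<open>The closeness tester\<close>

text \<open>The choice depends on the reference state only, so the tester may use it without knowing
  the oracles.\<close>

definition start_unitary :: "nat \<Rightarrow> complex vec \<Rightarrow> complex mat" where
  "start_unitary d g = (SOME G. unitary_mat d G \<and> G *\<^sub>v unit_vec d 0 = g)"

lemma start_unitary:
  assumes "unit_state d g"
  shows "unitary_mat d (start_unitary d g)" "start_unitary d g *\<^sub>v unit_vec d 0 = g"
  using unitary_mat_first_col[OF assms]
    someI[of "\<lambda>G. unitary_mat d G \<and> G *\<^sub>v unit_vec d 0 = g"]
  unfolding start_unitary_def by metis+

text \<open>The argument of \<open>rounds\<close> is the reciprocal of the least possible value of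
  sin \<theta> in the far case. The \<open>Suc\<close> includes the last exponent itself.\<close>

definition search_circuits :: "nat \<Rightarrow> real \<Rightarrow> nat \<Rightarrow> complex mat \<Rightarrow> gate list list" where
  "search_circuits n \<epsilon> d G = schedule
     (amplified (2 * d * n) {d * n..<d * n + n} (difference_circuit d n G))
     (Suc (rounds (2 * sqrt (real n) / \<epsilon>)))"

text \<open>The first gate sends the initial state to basis state 0, in which every run of
  \<open>search\<close> starts; each circuit recreates the reference state by itself.\<close>

definition closeness_program :: "nat \<Rightarrow> real \<Rightarrow> nat \<Rightarrow> complex mat \<Rightarrow> program" where
  "closeness_program n \<epsilon> d G = Unitary (mat_adjoint (lift_main n G))
     (search (2 * d * n) {d * n..<d * n + n} (search_circuits n \<epsilon> d G))"

lemma valid_search_circuits: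
  assumes "unitary_mat d G" "0 < n" "A \<in> set (search_circuits n \<epsilon> d G)"
  shows "valid_circuit (2 * d * n) A"
  using assms set_schedule unfolding search_circuits_def
  by (metis valid_circuit_amplified valid_difference_circuit)

lemma valid_closeness_program:
  assumes "unitary_mat d G" "0 < n" "0 < d"
  shows "valid_program (2 * d * n) (closeness_program n \<epsilon> d G)"
  using assms
  by (auto simp: closeness_program_def unitary_mat_adjoint unitary_lift_main
      intro!: valid_program_search valid_search_circuits)

lemma two_sqrt_div_ge_1:
  assumes "n \<ge> 1" "0 < \<epsilon>" "\<epsilon> < 1"
  shows "1 \<le> 2 * sqrt (real n) / \<epsilon>"
proof -
  have "1 \<le> sqrt (real n)" using assms by simp
  then have "\<epsilon> \<le> 2 * sqrt (real n)" using assms by linarith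
  then show ?thesis using assms by (simp add: pos_le_divide_eq)
qed

lemma sum_powers_3: "2 * (\<Sum>k<N. 3 ^ k) + 1 = (3 ^ N :: nat)"
  by (induction N) auto

text \<open>The basic circuit makes 4 calls and each exponent is used 4 times. With K the last
  exponent, the geometric sum gives at most 8 * 3^(K+1) = 24 * 3^K calls, and 3^K is at most 3 * 2
  sqrt(n) / \<epsilon>, whence 24 * 6 = 144.\<close>

lemma calls_closeness_program:
  assumes "n \<ge> 1" "0 < \<epsilon>" "\<epsilon> < 1" "0 < d"
  shows "real (calls (closeness_program n \<epsilon> d G)) \<le> 144 * (sqrt (real n) / \<epsilon>)"
proof -
  let ?K = "rounds (2 * sqrt (real n) / \<epsilon>)"
  have "calls (closeness_program n \<epsilon> d G) \<le> sum_list (map circuit_queries (search_circuits n \<epsilon> d G))"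
    unfolding closeness_program_def using assms by (simp add: calls_search)
  also have "\<dots> = 16 * (\<Sum>k<Suc ?K. 3 ^ k)"
    unfolding search_circuits_def sum_list_schedule circuit_queries_amplified
      circuit_queries_difference_circuit by (simp only: sum_distrib_left) (simp add: algebra_simps)
  also have "\<dots> \<le> 8 * 3 ^ Suc ?K" using sum_powers_3[of "Suc ?K"] by simp
  finally have "real (calls (closeness_program n \<epsilon> d G)) \<le> real (8 * 3 ^ Suc ?K)"
    by (simp only: of_nat_le_iff)
  also have "\<dots> = 24 * 3 ^ ?K" by simp
  also have "\<dots> \<le> 24 * (3 * (2 * sqrt (real n) / \<epsilon>))"
    using rounds(2)[OF two_sqrt_div_ge_1[OF assms(1-3)]] by simp
  finally show ?thesis by simp
qed

text \<open>Cauchy-Schwarz against the constant vector, obtained by bounding each product by the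
  mean of the two squares. It compares the 1-norm with the 2-norm.\<close>

lemma sum_squared_le:
  fixes f :: "nat \<Rightarrow> real"
  shows "(\<Sum>i<n. f i)\<^sup>2 \<le> real n * (\<Sum>i<n. (f i)\<^sup>2)"
proof -
  have "(\<Sum>i<n. f i)\<^sup>2 = (\<Sum>i<n. \<Sum>j<n. f i * f j)"
    by (simp add: power2_eq_square sum_product)
  also have "\<dots> \<le> (\<Sum>i<n. \<Sum>j<n. ((f i)\<^sup>2 + (f j)\<^sup>2) / 2)"
  proof (intro sum_mono)
    show "f i * f j \<le> ((f i)\<^sup>2 + (f j)\<^sup>2) / 2" for i j
      using sum_squares_bound[of "f i" "f j"] by simp
  qed
  also have "\<dots> = real n * (\<Sum>i<n. (f i)\<^sup>2)"
    by (simp add: sum.distrib flip: sum_divide_distrib sum_distrib_left)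
  finally show ?thesis .
qed

text \<open>The error is one-sided: for equal distributions the angle is 0, stays 0 under tripling,
  and no marked outcome ever occurs. In the far case some number of rounds brings the angle into the
  good range.\<close>

lemma output_prob_closeness_program:
  assumes n: "n \<ge> 1" and eps: "0 < \<epsilon>" "\<epsilon> < 1"
    and a0: "unit_state dA a0" and b0: "unit_state n b0"
    and p: "distribution n p" and q: "distribution n q"
    and orc_p: "purified_oracle dA n a0 b0 p Up" and orc_q: "purified_oracle dA n a0 b0 q Uq"
  defines "d \<equiv> dA * n"
  defines "prog \<equiv> closeness_program n \<epsilon> d (start_unitary d (kron_vec a0 b0))"
  shows "(\<forall>i<n. p i = q i) \<Longrightarrow> output_prob n Up Uq True prog (initial_state n a0 b0) = 1"
    "\<epsilon> \<le> (\<Sum>i<n. \<bar>p i - q i\<bar>) \<Longrightarrow> 2 / 3 \<le> output_prob n Up Uq False prog (initial_state n a0 b0)"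
proof -
  define G where "G = start_unitary d (kron_vec a0 b0)"
  have g: "unit_state d (kron_vec a0 b0)" unfolding d_def using a0 b0 by (rule unit_state_kron_vec)
  note G = start_unitary[OF g, folded G_def]
  have d0: "0 < d" using g by (rule unit_state_pos)
  have n0: "0 < n" using n by simp
  interpret oracles d n Up Uq
    using orc_p orc_q by unfold_locales (auto simp: purified_oracle_def d_def)
  define S where "S = {d * n..<d * n + n}"
  have "d * n + n \<le> D" using d0 by simp
  then have S: "S \<subseteq> {..<D}"
    unfolding S_def by (meson atLeastLessThan_iff lessThan_iff less_le_trans subsetI)
  have D0: "0 < D" using d0 n0 by simp
  define A where "A = difference_circuit d n G"
  have A: "valid_circuit D A" unfolding A_def using G(1) n0 by (rule valid_difference_circuit)
  define x where "x = (\<Sum>w<n. (p w - q w)\<^sup>2) / 4"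
  \<comment> \<open>As \<open>G\<close> sends basis state 0 to the reference state, the two marginal
    conditions are those of the oracles for \<open>p\<close> and \<open>q\<close>.\<close>
  have x: "success_prob D S (circuit_mat A) = x"
    unfolding S_def A_def x_def
  proof (rule success_prob_difference_circuit[OF G(1) n0 _ d0], unfold G(2))
    show "n dvd d" by (simp add: d_def)
  qed (use purified_oracle_marginal[OF orc_p p] purified_oracle_marginal[OF orc_q q] in
      \<open>auto simp: d_def\<close>)
  have x01: "0 \<le> x" "x \<le> 1"
    using success_prob_bounds[OF unitary_circuit_mat[OF A] D0 S] x by auto
  define \<theta> where "\<theta> = arcsin (sqrt x)"
  have sx: "- 1 \<le> sqrt x" using real_sqrt_ge_zero[OF x01(1)] by linarith
  then have sin: "sin \<theta> = sqrt x" using x01 by (simp add: \<theta>_def)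
  have \<theta>: "0 \<le> \<theta>" "\<theta> \<le> pi / 2" 
    using x01 sx arcsin_bounded[of "sqrt x"] by (auto simp: \<theta>_def arcsin_nonneg)
  define K where "K = rounds (2 * sqrt (real n) / \<epsilon>)"
  define fail where "fail = (\<Prod>k<Suc K. (1 - (sin (3 ^ k * \<theta>))\<^sup>2) ^ 4)"
  have lift: "lift_main n G \<in> carrier_mat D D"
    using unitary_mat_carrier[OF unitary_lift_main[OF G(1)]] .
  have "initial_state n a0 b0 = reg n 0 (G *\<^sub>v unit_vec d 0) 0"
    by (simp add: initial_state_def reg_def G(2))
  also have "\<dots> = lift_main n G *\<^sub>v unit_vec D 0"
    using unitary_mat_carrier[OF G(1)] d0 n0
    by (simp add: reg_unit_vec flip: lift_main_reg[of G d])
  finally have "mat_adjoint (lift_main n G) *\<^sub>v initial_state n a0 b0 = unit_vec D 0"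
    using unitary_lift_main[OF G(1), of n] lift
    by (simp add: unitary_mat_def flip: assoc_mult_mat_vec[of _ D D _ D])
  then have "output_prob n Up Uq b prog (initial_state n a0 b0) =
      output_prob n Up Uq b (search D S (search_circuits n \<epsilon> d G)) (1 \<cdot>\<^sub>v unit_vec D 0)" for b
    by (simp add: prog_def closeness_program_def S_def flip: G_def)
  also have "\<dots> b = (if b then fail else 1 - fail)" for b
  proof -
    have "(\<Prod>A\<leftarrow>search_circuits n \<epsilon> d G. 1 - success_prob D S (circuit_mat A)) = fail"
      unfolding search_circuits_def prod_list_schedule S_def[symmetric] A_def[symmetric] fail_def K_def
      using success_prob_amplified[OF A D0 S, of \<theta>] x x01 sin by simp
    then show ?thesis
      using valid_search_circuits[OF G(1) n0]
      by (subst output_prob_search[OF _ D0 S]) auto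
  qed
  finally have prob: "output_prob n Up Uq b prog (initial_state n a0 b0) = (if b then fail else 1 - fail)" for b .
  show "output_prob n Up Uq True prog (initial_state n a0 b0) = 1" if "\<forall>i<n. p i = q i"
  proof -
    have "x = 0" using that by (simp add: x_def)
    then show ?thesis by (simp add: prob fail_def \<theta>_def)
  qed
  show "2 / 3 \<le> output_prob n Up Uq False prog (initial_state n a0 b0)" if far: "\<epsilon> \<le> (\<Sum>i<n. \<bar>p i - q i\<bar>)"
  proof -
    \<comment> \<open>The distance promise becomes \<epsilon>^2 \<le> 4 x n, that is, sin \<theta>
      is at least \<epsilon> / (2 sqrt(n)).\<close>
    have "\<epsilon>\<^sup>2 \<le> (\<Sum>i<n. \<bar>p i - q i\<bar>)\<^sup>2" using far eps by (intro power_mono) auto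
    also have "\<dots> \<le> real n * (\<Sum>i<n. \<bar>p i - q i\<bar>\<^sup>2)"
      by (rule sum_squared_le)
    also have "\<dots> = 4 * x * real n" by (simp add: x_def)
    finally have "sqrt (\<epsilon>\<^sup>2) \<le> sqrt (4 * x * real n)" by (rule real_sqrt_le_mono)
    then have "\<epsilon> \<le> 2 * sqrt (real n) * sqrt x" using eps by (simp add: real_sqrt_mult mult_ac)
    then have "1 \<le> (2 * sqrt (real n) / \<epsilon>) * sqrt x" using eps by (simp add: field_simps)
    also have "\<dots> \<le> 3 ^ K * \<theta>"
      using rounds(1)[OF two_sqrt_div_ge_1[OF n eps]] sin_x_le_x[OF \<theta>(1)] sin x01
      by (intro mult_mono) (auto simp: K_def)
    \<comment> \<open>The chain gives 1 as a lower bound, and pi < 4 makes pi/6 smaller than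
      that.\<close>
    finally have "pi / 6 \<le> 3 ^ K * \<theta>" using pi_less_4 by linarith
    from exists_good_angle[OF \<theta> this] obtain k where
      k: "k < Suc K" "1 / 4 \<le> (sin (3 ^ k * \<theta>))\<^sup>2" using le_imp_less_Suc by blast
    have "fail \<le> (1 - (sin (3 ^ k * \<theta>))\<^sup>2) ^ 4"
      unfolding fail_def by (rule prod_le_factor) (use k in \<open>auto intro!: power_le_one simp: abs_square_le_1\<close>)
    also have "\<dots> \<le> (3 / 4) ^ 4"
      using k by (intro power_mono) (auto simp: abs_square_le_1)
    also have "\<dots> \<le> 1 / 3" by (simp add: power_divide)
    finally show ?thesis by (simp add: prob)
  qed
qed

definition closeness_tester ::
  "nat \<Rightarrow> real \<Rightarrow> nat \<Rightarrow> complex vec \<Rightarrow> complex vec \<Rightarrow> nat \<times> program" where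
  "closeness_tester n \<epsilon> dA a0 b0 =
     (n, closeness_program n \<epsilon> (dA * n) (start_unitary (dA * n) (kron_vec a0 b0)))"

theorem corollary6:
  shows "\<exists>(C :: real) (tester :: nat \<Rightarrow> real \<Rightarrow> nat \<Rightarrow> complex vec \<Rightarrow> complex vec \<Rightarrow> nat \<times> program).
    C > 0 \<and>
    (\<forall>(n :: nat) (\<epsilon> :: real) (dA :: nat) (a0 :: complex vec) (b0 :: complex vec).
       n \<ge> 1 \<and> 0 < \<epsilon> \<and> \<epsilon> < 1 \<and> unit_state dA a0 \<and> unit_state n b0 \<longrightarrow>
       (case tester n \<epsilon> dA a0 b0 of (dW, prog) \<Rightarrow>
          dW \<ge> 1 \<and>
          valid_program (total_dim dA n dW) prog \<and>
          real (calls prog) \<le> C * (sqrt (real n) / \<epsilon>) \<and>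
          (\<forall>(p :: nat \<Rightarrow> real) (q :: nat \<Rightarrow> real) (Up :: complex mat) (Uq :: complex mat).
             distribution n p \<and> distribution n q \<and>
             purified_oracle dA n a0 b0 p Up \<and> purified_oracle dA n a0 b0 q Uq \<longrightarrow>
             ((\<forall>i<n. p i = q i) \<longrightarrow>
                output_prob dW Up Uq True prog (initial_state dW a0 b0) \<ge> 2 / 3) \<and>
             ((\<Sum>i<n. \<bar>p i - q i\<bar>) \<ge> \<epsilon> \<longrightarrow>
                output_prob dW Up Uq False prog (initial_state dW a0 b0) \<ge> 2 / 3))))"
proof (intro exI[of _ 144] exI[of _ closeness_tester] conjI allI impI, goal_cases)
  case 1
  show ?case by simp
next
  case (2 n \<epsilon> dA a0 b0)
  let ?d = "dA * n"
  have g: "unit_state ?d (kron_vec a0 b0)" using 2 by (simp add: unit_state_kron_vec)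
  then have "0 < ?d" by (rule unit_state_pos)
  then show ?case
    unfolding closeness_tester_def prod.case
  proof (intro conjI allI impI, goal_cases)
    case 2
    then show ?case using \<open>n \<ge> 1 \<and> _\<close> valid_closeness_program[OF start_unitary(1)[OF g]] by simp
  next
    case 3
    then show ?case using \<open>n \<ge> 1 \<and> _\<close> by (intro calls_closeness_program) auto
  next
    case (4 p q Up Uq)
    then show ?case
      using \<open>n \<ge> 1 \<and> _\<close> output_prob_closeness_program(1)[of n \<epsilon> dA a0 b0 p q Up Uq] by simp
  next
    case (5 p q Up Uq)
    then show ?case
      using \<open>n \<ge> 1 \<and> _\<close> by (intro output_prob_closeness_program(2)[where p = p and q = q]) auto
  qed (use 2 in simp)
qed

end
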